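(* Let $n\ge 2$, $M\ge 1$, let $\Omega\subset\mathbb{R}^n$ be a bounded Lipschitz domain and let $D\subset\Omega$ be $\mathcal{L}^n$-measurable with $0\le\mathcal{L}^n(D)<\mathcal{L}^n(\Omega)$. Fix $\zeta>1$, $\lambda>0$ and $f\in L^{\zeta}(\Omega-D)^M$. Let $F:\mathbb{R}^{nM}\to[0,\infty)$ be of class $C^1$, strictly convex, with $F(0)=0$, $|DF(P)|\le\nu_1$ and $F(P)\ge\nu_2|P|-\nu_3$ for all $P$, where $\nu_1,\nu_2>0$, $\nu_3\in\mathbb{R}$. For $w\in W^{1,1}(\Omega)^M\cap L^{\zeta}(\Omega-D)^M$ and $\varkappa\in L^\infty(\Omega)^{nM}$ set $$l(w,\varkappa):=\int_\Omega[\varkappa:\nabla w-F^*(\varkappa)]\,dx+\frac{\lambda}{\zeta}\int_{\Omega-D}|w-f|^\zeta dx,\qquad R[\varkappa]:=\inf_{w\in W^{1,1}(\Omega)^M\cap L^{\zeta}(\Omega-D)^M} l(w,\varkappa),$$ and $I[w]:=\int_\Omega F(\nabla w)\,dx+\frac{\lambda}{\zeta}\int_{\Omega-D}|w-f|^\zeta dx$. Then: (a) The problem of maximizing $R$ over $L^\infty(\Omega)^{nM}$ has at least one solution, and $$\inf_{v\in W^{1,1}(\Omega)^M\cap L^{\zeta}(\Omega-D)^M}I[v]=\sup_{\sigma\in L^\infty(\Omega)^{nM}}R[\sigma].$$ (b) If $F^*$ is strictly convex on the set $\{p\in\mathbb{R}^{nM}: F^*(p)<\infty\}$, then the maximizer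 of $R$ is unique.
   Context: $F^*(Q):=\sup_{P\in\mathbb{R}^{nM}}[P:Q-F(P)]$ is the convex conjugate of $F$, with values in $(-\infty,\infty]$; $R$ takes values in $[-\infty,\infty]$. $W^{1,1}(\Omega)^M\cap L^{\zeta}(\Omega-D)^M$ denotes the set of $w\in W^{1,1}(\Omega)^M$ whose restriction to $\Omega-D$ lies in $L^\zeta(\Omega-D)^M$. $A:B$ denotes the Euclidean inner product of matrices. *)

theory Defs
  imports "HOL-Analysis.Analysis"
begin

definition strict_convex_on :: "'a::real_vector set \<Rightarrow> ('a \<Rightarrow> real) \<Rightarrow> bool" where
  "strict_convex_on S f \<longleftrightarrow> convex S \<and>
     (\<forall>x\<in>S. \<forall>y\<in>S. x \<noteq> y \<longrightarrow> (\<forall>t::real. 0 < t \<and> t < 1 \<longrightarrow>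
        f ((1 - t) *\<^sub>R x + t *\<^sub>R y) < (1 - t) * f x + t * f y))"

definition conj_fun :: "('a::real_inner \<Rightarrow> real) \<Rightarrow> 'a \<Rightarrow> ereal" where
  "conj_fun F Q = (SUP P. ereal (P \<bullet> Q - F P))"

definition lipschitz_domain :: "(real^'n) set \<Rightarrow> bool" where
  "lipschitz_domain \<Omega> \<longleftrightarrow> open \<Omega> \<and> connected \<Omega> \<and> \<Omega> \<noteq> {} \<and>
     (\<forall>x0\<in>frontier \<Omega>. \<exists>r>0. \<exists>e::real^'n. norm e = 1 \<and>
        (\<exists>g L. L-lipschitz_on {y. y \<bullet> e = 0} g \<and>
          \<Omega> \<inter> ball x0 r = {x \<in> ball x0 r. x \<bullet> e < g (x - (x \<bullet> e) *\<^sub>R e)}))"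

definition pderiv :: "'n \<Rightarrow> (real^'n \<Rightarrow> real) \<Rightarrow> real^'n \<Rightarrow> real" where
  "pderiv j \<phi> x = frechet_derivative \<phi> (at x) (axis j 1)"

fun iter_pderiv :: "'n list \<Rightarrow> (real^'n \<Rightarrow> real) \<Rightarrow> real^'n \<Rightarrow> real" where
  "iter_pderiv [] \<phi> = \<phi>"
| "iter_pderiv (j # js) \<phi> = pderiv j (iter_pderiv js \<phi>)"

definition smooth_fun :: "(real^'n \<Rightarrow> real) \<Rightarrow> bool" where
  "smooth_fun \<phi> \<longleftrightarrow> (\<forall>js x. iter_pderiv js \<phi> differentiable (at x))"

definition test_fun :: "(real^'n) set \<Rightarrow> (real^'n \<Rightarrow> real) \<Rightarrow> bool" where
  "test_fun \<Omega> \<phi> \<longleftrightarrow> smooth_fun \<phi> \<and> compact (closure {x. \<phi> x \<noteq> 0})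
     \<and> closure {x. \<phi> x \<noteq> 0} \<subseteq> \<Omega>"

definition is_weak_grad :: "(real^'n) set \<Rightarrow> (real^'n \<Rightarrow> real^'m) \<Rightarrow> (real^'n \<Rightarrow> real^'n^'m) \<Rightarrow> bool" where
  "is_weak_grad \<Omega> w G \<longleftrightarrow> integrable (lebesgue_on \<Omega>) G \<and>
     (\<forall>\<phi>. test_fun \<Omega> \<phi> \<longrightarrow> (\<forall>i j.
        (\<integral>x. w x $ i * pderiv j \<phi> x \<partial>lebesgue_on \<Omega>) = - (\<integral>x. G x $ i $ j * \<phi> x \<partial>lebesgue_on \<Omega>)))"

definition W11 :: "(real^'n) set \<Rightarrow> (real^'n \<Rightarrow> real^'m) set" where
  "W11 \<Omega> = {w. integrable (lebesgue_on \<Omega>) w \<and> (\<exists>G. is_weak_grad \<Omega> w G)}"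

definition weak_grad :: "(real^'n) set \<Rightarrow> (real^'n \<Rightarrow> real^'m) \<Rightarrow> real^'n \<Rightarrow> real^'n^'m" where
  "weak_grad \<Omega> w = (SOME G. is_weak_grad \<Omega> w G)"

definition Lp :: "real \<Rightarrow> (real^'n) set \<Rightarrow> (real^'n \<Rightarrow> 'b::euclidean_space) set" where
  "Lp p A = {u. u \<in> borel_measurable (lebesgue_on A) \<and>
                integrable (lebesgue_on A) (\<lambda>x. norm (u x) powr p)}"

definition Linf :: "(real^'n) set \<Rightarrow> (real^'n \<Rightarrow> 'b::euclidean_space) set" where
  "Linf A = {u. u \<in> borel_measurable (lebesgue_on A) \<and>
                (\<exists>C. AE x in lebesgue_on A. norm (u x) \<le> C)}"

definition ereal_integral :: "'a measure \<Rightarrow> ('a \<Rightarrow> ereal) \<Rightarrow> ereal" where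
  "ereal_integral M g =
     enn2ereal (\<integral>\<^sup>+x. e2ennreal (g x) \<partial>M) - enn2ereal (\<integral>\<^sup>+x. e2ennreal (- g x) \<partial>M)"

definition fidelity :: "(real^'n) set \<Rightarrow> (real^'n) set \<Rightarrow> real \<Rightarrow> real \<Rightarrow> (real^'n \<Rightarrow> real^'m)
    \<Rightarrow> (real^'n \<Rightarrow> real^'m) \<Rightarrow> real" where
  "fidelity \<Omega> D \<zeta> lam f w = lam / \<zeta> * (\<integral>x. norm (w x - f x) powr \<zeta> \<partial>lebesgue_on (\<Omega> - D))"

definition lfun :: "(real^'n^'m \<Rightarrow> real) \<Rightarrow> (real^'n) set \<Rightarrow> (real^'n) set \<Rightarrow> real \<Rightarrow> real
    \<Rightarrow> (real^'n \<Rightarrow> real^'m) \<Rightarrow> (real^'n \<Rightarrow> real^'m) \<Rightarrow> (real^'n \<Rightarrow> real^'n^'m) \<Rightarrow> ereal" where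
  "lfun F \<Omega> D \<zeta> lam f w \<kappa> =
     ereal_integral (lebesgue_on \<Omega>) (\<lambda>x. ereal (\<kappa> x \<bullet> weak_grad \<Omega> w x) - conj_fun F (\<kappa> x))
     + ereal (fidelity \<Omega> D \<zeta> lam f w)"

definition Rfun :: "(real^'n^'m \<Rightarrow> real) \<Rightarrow> (real^'n) set \<Rightarrow> (real^'n) set \<Rightarrow> real \<Rightarrow> real
    \<Rightarrow> (real^'n \<Rightarrow> real^'m) \<Rightarrow> (real^'n \<Rightarrow> real^'n^'m) \<Rightarrow> ereal" where
  "Rfun F \<Omega> D \<zeta> lam f \<kappa> = (INF w \<in> W11 \<Omega> \<inter> Lp \<zeta> (\<Omega> - D). lfun F \<Omega> D \<zeta> lam f w \<kappa>)"

definition Ifun :: "(real^'n^'m \<Rightarrow> real) \<Rightarrow> (real^'n) set \<Rightarrow> (real^'n) set \<Rightarrow> real \<Rightarrow> real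
    \<Rightarrow> (real^'n \<Rightarrow> real^'m) \<Rightarrow> (real^'n \<Rightarrow> real^'m) \<Rightarrow> real" where
  "Ifun F \<Omega> D \<zeta> lam f w =
     (\<integral>x. F (weak_grad \<Omega> w x) \<partial>lebesgue_on \<Omega>) + fidelity \<Omega> D \<zeta> lam f w"

end

theory Submission
  imports Defs
begin

text \<open>
  The dual problem is solved by a subgradient of the perturbed value function
  \<open>h p = inf\<^sub>w (\<integral> F (\<nabla>w + p) + fidelity w)\<close> on \<open>L\<^sup>1\<close>. Since \<open>F\<close> is convex and Lipschitz, so is \<open>h\<close>; the
  Hahn-Banach theorem and the duality of \<open>L\<^sup>1\<close> and \<open>L\<^sup>\<infinity>\<close> yield a bounded \<open>\<sigma>\<close> with
  \<open>\<integral> \<sigma> : p \<le> h p - h 0\<close> for all \<open>p\<close>. Substituting \<open>p = q - \<nabla>w\<close> and taking the supremum over \<open>q\<close>, which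
  produces \<open>\<integral> F\<^sup>*(\<sigma>)\<close>, gives \<open>l w \<sigma> \<ge> h 0 = inf I\<close> for every \<open>w\<close>. The converse inequality
  is Young's. If two maximizers differed on a set of positive measure, strict convexity of \<open>F\<^sup>*\<close>
  would make \<open>R\<close> strictly larger at their midpoint.
\<close>

subsection \<open>A Hahn-Banach theorem for spaces of functions\<close>

text \<open>Only the gradient is perturbed, and by arbitrary p in L^1. The bound on the derivative
  of F makes h globally Lipschitz in the L^1 norm, so every functional below its directional
  derivative at 0 is bounded and therefore has an L^\<infinity> density; no regularity of \<sigma>
  has to be proved separately. Convexity of h comes from joint convexity of the perturbed energy in
  (p, w). As \<open>weak_grad\<close> is an arbitrary choice of a weak gradient, its linearity in w
  holds only almost everywhere, and only once weak gradients are known to be unique; this is why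
  explicit smooth bump functions appear. The delicate step is to pull the supremum over q inside the
  integral. A measurable maximizer need not exist, so a running maximum over countably many matrices
  is used: each stage takes finitely many values, hence is an admissible q, and monotone convergence
  does the rest. The conjugate may be infinite. Being nonnegative, it has an integral in
  [0, \<infinity>] that does not depend on w, and this is the only infinite quantity to be
  tracked.\<close>

lemma cINF_le_weighted_add:
  fixes h :: "'u \<Rightarrow> real" and f :: "'s \<Rightarrow> real" and g :: "'t \<Rightarrow> real"
  assumes "bdd_below (h ` U)" "S \<noteq> {}" "T \<noteq> {}" "a > 0" "b > 0"
    and le: "\<And>s t. s \<in> S \<Longrightarrow> t \<in> T \<Longrightarrow> \<exists>u\<in>U. h u \<le> a * f s + b * g t"
  shows "(INF u\<in>U. h u) \<le> a * (INF s\<in>S. f s) + b * (INF t\<in>T. g t)"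
proof -
  let ?H = "INF u\<in>U. h u"
  \<comment> \<open>One witness u per pair (s, t) decouples the two infima: with s fixed, the
    inequality is solved for \<open>g t\<close>, then for \<open>f s\<close>. Sublinearity and
    convexity of all infima below rest on this.\<close>
  have st: "?H \<le> a * f s + b * g t" if "s \<in> S" "t \<in> T" for s t
    using le[OF that] cINF_lower[OF assms(1)] by force
  have "(?H - a * f s) / b \<le> (INF t\<in>T. g t)" if "s \<in> S" for s
    using st[OF that] assms by (intro cINF_greatest) (auto simp: field_simps)
  then have "(?H - b * (INF t\<in>T. g t)) / a \<le> (INF s\<in>S. f s)"
    using assms by (intro cINF_greatest) (auto simp: field_simps)
  then show ?thesis using assms by (simp add: field_simps)
qed

text \<open>Homogeneity is demanded only as an inequality, which is what infima readily deliver;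
  scaling back by \<open>inverse c\<close> gives equality on a subspace.\<close>

definition sublinear_on :: "('a \<Rightarrow> 'b::real_vector) set \<Rightarrow> (('a \<Rightarrow> 'b) \<Rightarrow> real) \<Rightarrow> bool" where
  "sublinear_on V q \<longleftrightarrow> (\<forall>f\<in>V. \<forall>g\<in>V. q (\<lambda>x. f x + g x) \<le> q f + q g)
     \<and> (\<forall>f\<in>V. \<forall>c>0. q (\<lambda>x. c *\<^sub>R f x) \<le> c * q f)"

definition linear_functional_on :: "('a \<Rightarrow> 'b::real_vector) set \<Rightarrow> (('a \<Rightarrow> 'b) \<Rightarrow> real) \<Rightarrow> bool" where
  "linear_functional_on V l \<longleftrightarrow> (\<forall>f\<in>V. \<forall>g\<in>V. l (\<lambda>x. f x + g x) = l f + l g)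
     \<and> (\<forall>f\<in>V. \<forall>c. l (\<lambda>x. c *\<^sub>R f x) = c * l f)"

definition function_subspace :: "('a \<Rightarrow> 'b::real_vector) set \<Rightarrow> bool" where
  "function_subspace V \<longleftrightarrow> (\<lambda>_. 0) \<in> V \<and> (\<forall>f\<in>V. \<forall>g\<in>V. (\<lambda>x. f x + g x) \<in> V)
     \<and> (\<forall>f\<in>V. \<forall>c. (\<lambda>x. c *\<^sub>R f x) \<in> V)"

lemma sublinear_on_addD: "sublinear_on V q \<Longrightarrow> f \<in> V \<Longrightarrow> g \<in> V \<Longrightarrow> q (\<lambda>x. f x + g x) \<le> q f + q g"
  and sublinear_on_scaleD: "sublinear_on V q \<Longrightarrow> f \<in> V \<Longrightarrow> c > 0 \<Longrightarrow> q (\<lambda>x. c *\<^sub>R f x) \<le> c * q f"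
  by (simp_all add: sublinear_on_def)

lemma sublinear_on_scale:
  assumes "sublinear_on V q" "function_subspace V" "f \<in> V" "c > 0"
  shows "q (\<lambda>x. c *\<^sub>R f x) = c * q f"
proof (rule antisym)
  show "q (\<lambda>x. c *\<^sub>R f x) \<le> c * q f" by (rule sublinear_on_scaleD[OF assms(1,3,4)])
  have "q (\<lambda>x. inverse c *\<^sub>R (c *\<^sub>R f x)) \<le> inverse c * q (\<lambda>x. c *\<^sub>R f x)"
  proof -
    have "(\<lambda>x. c *\<^sub>R f x) \<in> V" using assms(2,3) unfolding function_subspace_def by blast
    moreover have "inverse c > 0" using assms by simp
    ultimately show ?thesis by (rule sublinear_on_scaleD[OF assms(1)])
  qed
  then show "c * q f \<le> q (\<lambda>x. c *\<^sub>R f x)" using assms(4) by (simp add: field_simps)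
qed

lemma sublinear_on_zero:
  assumes "sublinear_on V q" "function_subspace V"
  shows "q (\<lambda>_. 0) = 0"
  using sublinear_on_scale[OF assms, of "\<lambda>_. 0" 2] assms(2) unfolding function_subspace_def by simp

lemma sublinear_on_uminus:
  assumes "sublinear_on V q" "function_subspace V" "f \<in> V"
  shows "- q (\<lambda>x. - f x) \<le> q f"
proof -
  have "(\<lambda>x. (-1) *\<^sub>R f x) \<in> V" using assms(2,3) unfolding function_subspace_def by blast
  then have "(\<lambda>x. - f x) \<in> V" by simp
  then have "q (\<lambda>x. f x + - f x) \<le> q f + q (\<lambda>x. - f x)" 
    by (rule sublinear_on_addD[OF assms(1,3)])
  then show ?thesis using sublinear_on_zero[OF assms(1,2)] by simp
qed

text \<open>The functional r with \<open>r u\<close> the infimum over t \<ge> 0 of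
  \<open>q (u + t g) - t * q g\<close> is again sublinear and lies below q (take t = 0). Minimality
  forces r = q, and the competitor t = 1 then yields the missing inequality. Subadditivity with - u
  bounds the infimum from below.\<close>

lemma minimal_sublinear_additive:
  fixes V :: "('a \<Rightarrow> 'b::real_vector) set"
  assumes V: "function_subspace V" and q: "sublinear_on V q"
    and min: "\<And>r. sublinear_on V r \<Longrightarrow> (\<And>f. f \<in> V \<Longrightarrow> r f \<le> q f) \<Longrightarrow> \<forall>f\<in>V. r f = q f"
    and f: "f \<in> V" and g: "g \<in> V"
  shows "q (\<lambda>x. f x + g x) = q f + q g"
proof (rule antisym)
  show "q (\<lambda>x. f x + g x) \<le> q f + q g" by (rule sublinear_on_addD[OF q f g])
  have Vadd: "(\<lambda>x. u x + v x) \<in> V" if "u \<in> V" "v \<in> V" for u v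
    using V that unfolding function_subspace_def by blast
  have Vsc: "(\<lambda>x. c *\<^sub>R u x) \<in> V" if "u \<in> V" for u c
    using V that unfolding function_subspace_def by blast
  have Vmin: "(\<lambda>x. - u x) \<in> V" if "u \<in> V" for u using Vsc[OF that, of "-1"] by simp
  have qadd: "q (\<lambda>x. u x + v x) \<le> q u + q v" if "u \<in> V" "v \<in> V" for u v
    by (rule sublinear_on_addD[OF q that])
  note qsc = sublinear_on_scale[OF q V]
  have qsc0: "q (\<lambda>x. t *\<^sub>R g x) = t * q g" if "t \<ge> 0" for t
    using qsc[OF g, of t] sublinear_on_zero[OF q V] that by (cases "t = 0") auto
  define k where "k u t = q (\<lambda>x. u x + t *\<^sub>R g x) - t * q g" for u t
  define r where "r u = (INF t\<in>{0::real..}. k u t)" for u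
  have bdd: "bdd_below (k u ` {0..})" if "u \<in> V" for u
  proof (rule bdd_belowI2)
    fix t :: real assume t: "t \<in> {0..}"
    have "q (\<lambda>x. (u x + t *\<^sub>R g x) + - u x) \<le> q (\<lambda>x. u x + t *\<^sub>R g x) + q (\<lambda>x. - u x)"
      by (intro qadd Vadd Vsc g that Vmin)
    then show "- q (\<lambda>x. - u x) \<le> k u t" using qsc0 t by (simp add: k_def)
  qed
  have "sublinear_on V r"
    unfolding sublinear_on_def
  proof (intro conjI ballI allI impI)
    fix u v assume u: "u \<in> V" and v: "v \<in> V"
    have "r (\<lambda>x. u x + v x) \<le> 1 * r u + 1 * r v"
      unfolding r_def
    proof (rule cINF_le_weighted_add)
      fix s t :: real assume st: "s \<in> {0..}" "t \<in> {0..}"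
      have "q (\<lambda>x. (u x + s *\<^sub>R g x) + (v x + t *\<^sub>R g x)) \<le> q (\<lambda>x. u x + s *\<^sub>R g x) + q (\<lambda>x. v x + t *\<^sub>R g x)"
        by (intro qadd Vadd Vsc g u v)
      then have "k (\<lambda>x. u x + v x) (s + t) \<le> 1 * k u s + 1 * k v t"
        by (simp add: k_def algebra_simps)
      then show "\<exists>w\<in>{0..}. k (\<lambda>x. u x + v x) w \<le> 1 * k u s + 1 * k v t"
        using st by (intro bexI[of _ "s + t"]) auto
    qed (use bdd[OF Vadd[OF u v]] in auto)
    then show "r (\<lambda>x. u x + v x) \<le> r u + r v" by simp
  next
    fix u and c :: real assume u: "u \<in> V" and c: "0 < c"
    have "r (\<lambda>x. c *\<^sub>R u x) / c \<le> r u"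
      unfolding r_def[of u]
    proof (rule cINF_greatest)
      fix t :: real assume t: "t \<in> {0..}"
      have "k (\<lambda>x. c *\<^sub>R u x) (c * t) = q (\<lambda>x. c *\<^sub>R (u x + t *\<^sub>R g x)) - c * t * q g"
        by (simp add: k_def algebra_simps)
      also have "\<dots> = c * k u t" using qsc[OF Vadd[OF u Vsc[OF g, of t]] c]
        by (simp add: k_def algebra_simps)
      finally have "r (\<lambda>x. c *\<^sub>R u x) \<le> c * k u t"
        unfolding r_def using cINF_lower[OF bdd[OF Vsc[OF u]], of "c * t" c] t c by simp
      then show "r (\<lambda>x. c *\<^sub>R u x) / c \<le> k u t" using c by (simp add: field_simps)
    qed auto
    then show "r (\<lambda>x. c *\<^sub>R u x) \<le> c * r u" using c by (simp add: field_simps)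
  qed
  moreover have "r u \<le> q u" if "u \<in> V" for u
    using cINF_lower[OF bdd[OF that], of 0] by (simp add: r_def k_def)
  ultimately have "q f = r f" using min f by force
  also have "r f \<le> k f 1" unfolding r_def by (rule cINF_lower[OF bdd[OF f]]) simp
  finally show "q f + q g \<le> q (\<lambda>x. f x + g x)" by (simp add: k_def)
qed

text \<open>Instead of extending a functional from smaller subspaces, Zorn's lemma picks a minimal
  sublinear functional below p. Minimality makes it additive, additivity makes it odd, and so it is
  homogeneous for all scalars.\<close>

theorem Hahn_Banach_functions:
  fixes V :: "('a \<Rightarrow> 'b::real_vector) set"
  assumes V: "function_subspace V" and p: "sublinear_on V p"
  obtains l where "linear_functional_on V l" "\<And>f. f \<in> V \<Longrightarrow> l f \<le> p f"
proof -
  \<comment> \<open>Fixing the value 0 outside V keeps chains from descending without bound there,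
    so that minimality concerns the values on V alone.\<close>
  define A where "A = {q. sublinear_on V q \<and> (\<forall>f\<in>V. q f \<le> p f) \<and> (\<forall>f. f \<notin> V \<longrightarrow> q f = 0)}"
  \<comment> \<open>The order is reversed: what is maximal for \<open>P\<close> is a minimal
    functional.\<close>
  define P where "P a b \<longleftrightarrow> (\<forall>f. b f \<le> a f)" for a b :: "('a \<Rightarrow> 'b) \<Rightarrow> real"
  have Vadd: "(\<lambda>x. u x + v x) \<in> V" if "u \<in> V" "v \<in> V" for u v
    using V that unfolding function_subspace_def by blast
  have Vsc: "(\<lambda>x. c *\<^sub>R u x) \<in> V" if "u \<in> V" for u c
    using V that unfolding function_subspace_def by blast
  have Vmin: "(\<lambda>x. - u x) \<in> V" if "u \<in> V" for u using Vsc[OF that, of "-1"] by simp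
  have Aext: "(\<lambda>f. if f \<in> V then q f else 0) \<in> A" if "sublinear_on V q" "\<And>f. f \<in> V \<Longrightarrow> q f \<le> p f" for q
    using that Vadd Vsc by (simp add: A_def sublinear_on_def)
  have "\<exists>m\<in>A. \<forall>a\<in>A. P m a \<longrightarrow> a = m"
  proof (rule predicate_Zorn)
    show "partial_order_on A (relation_of P A)"
    proof (rule partial_order_on_relation_ofI)
      show "P a c" if "P a b" "P b c" for a b c using that unfolding P_def by (meson order_trans)
      show "a = b" if "P a b" "P b a" for a b using that unfolding P_def by (intro ext antisym) auto
    qed (simp add: P_def)
  next
    fix C assume C: "C \<in> Chains (relation_of P A)"
    then have CA: "C \<subseteq> A" by (rule Chains_relation_of)
    have tot: "P a b \<or> P b a" if "a \<in> C" "b \<in> C" for a b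
      using C that unfolding Chains_def relation_of_def by auto
    show "\<exists>u\<in>A. \<forall>a\<in>C. P a u"
    proof (cases "C = {}")
      case True
      then show ?thesis using Aext[OF p] by auto
    next
      case False
      have sub: "sublinear_on V q" and le: "f \<in> V \<Longrightarrow> q f \<le> p f" and z: "f \<notin> V \<Longrightarrow> q f = 0"
        if "q \<in> C" for q f
        using that CA by (auto simp: A_def)
      define r where "r f = (INF q\<in>C. q f)" for f
      \<comment> \<open>The bound is uniform over the chain, since q f \<ge> - q (- f) \<ge> - p (-
        f).\<close>
      have bdd: "bdd_below ((\<lambda>q. q f) ` C)" if "f \<in> V" for f
      proof (rule bdd_belowI2)
        fix q assume q: "q \<in> C"
        show "- p (\<lambda>x. - f x) \<le> q f"
          using sublinear_on_uminus[OF sub[OF q] V that] le[OF q Vmin[OF that]] by linarith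
      qed
      have "sublinear_on V r"
        unfolding sublinear_on_def
      proof (intro conjI ballI allI impI)
        fix u v assume u: "u \<in> V" and v: "v \<in> V"
        have "r (\<lambda>x. u x + v x) \<le> 1 * r u + 1 * r v"
          unfolding r_def
        proof (rule cINF_le_weighted_add)
          fix s t assume st: "s \<in> C" "t \<in> C"
          have *: "w (\<lambda>x. u x + v x) \<le> w u + w v" if "w \<in> C" for w
            by (rule sublinear_on_addD[OF sub[OF that] u v])
          \<comment> \<open>The members of a chain are comparable, and the smaller of s and t serves
            as the common witness for both infima.\<close>
          consider "P s t" | "P t s" using tot[OF st] by blast
          then show "\<exists>w\<in>C. w (\<lambda>x. u x + v x) \<le> 1 * s u + 1 * t v"
          proof cases
            case 1
            then have "t u \<le> s u" by (simp add: P_def)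
            with *[OF st(2)] st(2) show ?thesis by (intro bexI[of _ t]) auto
          next
            case 2
            then have "s v \<le> t v" by (simp add: P_def)
            with *[OF st(1)] st(1) show ?thesis by (intro bexI[of _ s]) auto
          qed
        qed (use bdd[OF Vadd[OF u v]] False in auto)
        then show "r (\<lambda>x. u x + v x) \<le> r u + r v" by simp
      next
        fix u and c :: real assume u: "u \<in> V" and c: "0 < c"
        have "r (\<lambda>x. c *\<^sub>R u x) / c \<le> r u"
          unfolding r_def[of u]
        proof (rule cINF_greatest)
          fix q assume q: "q \<in> C"
          have "r (\<lambda>x. c *\<^sub>R u x) \<le> q (\<lambda>x. c *\<^sub>R u x)"
            unfolding r_def by (rule cINF_lower[OF bdd[OF Vsc[OF u]] q])
          also have "\<dots> \<le> c * q u" by (rule sublinear_on_scaleD[OF sub[OF q] u c])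
          finally show "r (\<lambda>x. c *\<^sub>R u x) / c \<le> q u" using c by (simp add: field_simps)
        qed (use False in auto)
        then show "r (\<lambda>x. c *\<^sub>R u x) \<le> c * r u" using c by (simp add: field_simps)
      qed
      moreover have rle: "r f \<le> q f" if "f \<in> V" "q \<in> C" for f q
        unfolding r_def by (rule cINF_lower[OF bdd[OF that(1)] that(2)])
      moreover have "r f \<le> p f" if "f \<in> V" for f
      proof -
        obtain q where q: "q \<in> C" using False by blast
        show ?thesis by (rule order_trans[OF rle[OF that q] le[OF q that]])
      qed
      ultimately have "(\<lambda>f. if f \<in> V then r f else 0) \<in> A" by (intro Aext) auto
      then show ?thesis by (rule bexI[rotated]) (auto simp: P_def rle z)
    qed
  qed
  then obtain m where mA: "m \<in> A" and min: "\<And>a. a \<in> A \<Longrightarrow> P m a \<Longrightarrow> a = m" by blast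
  have m: "sublinear_on V m" and mle: "\<And>f. f \<in> V \<Longrightarrow> m f \<le> p f" and mz: "\<And>f. f \<notin> V \<Longrightarrow> m f = 0"
    using mA by (auto simp: A_def)
  have add: "m (\<lambda>x. f x + g x) = m f + m g" if "f \<in> V" "g \<in> V" for f g
  proof (rule minimal_sublinear_additive[OF V m _ that])
    fix r assume r: "sublinear_on V r" "\<And>f. f \<in> V \<Longrightarrow> r f \<le> m f"
    have "(\<lambda>f. if f \<in> V then r f else 0) \<in> A"
      using r(2) mle by (intro Aext[OF r(1)]) (rule order_trans)
    moreover have "P m (\<lambda>f. if f \<in> V then r f else 0)" using r mz by (auto simp: P_def)
    ultimately have "(\<lambda>f. if f \<in> V then r f else 0) = m" by (rule min)
    from fun_cong[OF this] have "(if f \<in> V then r f else 0) = m f" for f .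
    then show "\<forall>f\<in>V. r f = m f" by presburger
  qed
  have neg: "m (\<lambda>x. - f x) = - m f" if "f \<in> V" for f
    using add[OF that Vmin[OF that]] sublinear_on_zero[OF m V] by simp
  have "m (\<lambda>x. c *\<^sub>R f x) = c * m f" if f: "f \<in> V" for f c
  proof -
    consider "c > 0" | "c = 0" | "c < 0" by linarith
    then show ?thesis
    proof cases
      case 1
      then show ?thesis by (rule sublinear_on_scale[OF m V f])
    next
      case 2
      then show ?thesis using sublinear_on_zero[OF m V] by simp
    next
      case 3
      then show ?thesis
        using sublinear_on_scale[OF m V f, of "- c"] neg[OF Vsc[OF f, of c]] by simp
    qed
  qed
  then have "linear_functional_on V m" using add unfolding linear_functional_on_def by blast
  then show thesis using mle by (rule that)
qed

subsection \<open>Duality of integrable and bounded functions\<close>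

lemma function_subspace_integrable:
  "function_subspace {f. integrable M (f :: 'a \<Rightarrow> 'b::{banach, second_countable_topology})}"
  by (auto simp: function_subspace_def)

text \<open>The set function A \<mapsto> \<open>l (indicator A)\<close> is signed. Adding C times
  the measure makes it nonnegative and at most 2C times the measure, so it becomes a finite,
  absolutely continuous measure. Its Radon-Nikodym density lies between 0 and 2C, and subtracting C
  undoes the shift.\<close>

lemma bounded_density_of_functional:
  fixes l :: "('a \<Rightarrow> real) \<Rightarrow> real"
  assumes "finite_measure M" and C0: "C \<ge> 0"
    and l: "linear_functional_on {f. integrable M f} l"
    and bound: "\<And>f. integrable M f \<Longrightarrow> \<bar>l f\<bar> \<le> C * (\<integral>x. \<bar>f x\<bar> \<partial>M)"
  obtains g where "g \<in> borel_measurable M" "\<And>x. \<bar>g x\<bar> \<le> C"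
    "\<And>A. A \<in> sets M \<Longrightarrow> l (indicator A) = (\<integral>x. g x * indicator A x \<partial>M)"
proof -
  interpret finite_measure M by fact
  have ind [simp]: "integrable M (indicator A :: _ \<Rightarrow> real)" if "A \<in> sets M" for A
    using that by (simp add: less_top[symmetric])
  have bnd: "\<bar>l (indicator A)\<bar> \<le> C * measure M A" if "A \<in> sets M" for A
    using bound[OF ind[OF that]] that by simp
  define N where "N A = ennreal (l (indicator A) + C * measure M A)" for A
  have nn: "0 \<le> l (indicator A) + C * measure M A" if "A \<in> sets M" for A
    using bnd[OF that] by linarith
  have Nle: "N A \<le> ennreal (2 * C) * emeasure M A" if "A \<in> sets M" for A
    using bnd[OF that] C0 unfolding N_def
    by (simp add: emeasure_eq_measure ennreal_mult'[symmetric] ennreal_leI)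
  have l0: "l (\<lambda>_. 0) = 0"
    using bound[of "\<lambda>_. 0"] by simp
  have pos: "positive (sets M) N"
    using l0 by (simp add: positive_def N_def indicator_def[abs_def])
  have add: "Measure_Space.additive (sets M) N"
    unfolding additive_def
  proof (intro ballI impI)
    fix A B assume A: "A \<in> sets M" and B: "B \<in> sets M" and d: "A \<inter> B = {}"
    have "indicator (A \<union> B) = (\<lambda>x. indicator A x + indicator B x :: real)"
      using d by (auto simp: fun_eq_iff indicator_def)
    then have "l (indicator (A \<union> B)) = l (indicator A) + l (indicator B)"
      using l A B unfolding linear_functional_on_def by simp
    then show "N (A \<union> B) = N A + N B"
      using nn A B d by (simp add: N_def ennreal_plus[symmetric] finite_measure_Union algebra_simps del: ennreal_plus)
  qed
  \<comment> \<open>Domination by 2C times a finite measure gives continuity at the empty set, which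
    upgrades finite to countable additivity.\<close>
  have ca: "countably_additive (sets M) N"
  proof (rule sets.empty_continuous_imp_countably_additive[OF pos add])
    show "\<forall>A\<in>sets M. N A \<noteq> \<infinity>" by (simp add: N_def)
    fix A :: "nat \<Rightarrow> _" assume A: "range A \<subseteq> sets M" "decseq A" "(\<Inter>i. A i) = {}"
    have "(\<lambda>i. emeasure M (A i)) \<longlonglongrightarrow> emeasure M (\<Inter>i. A i)"
      using A by (intro Lim_emeasure_decseq) auto
    then have "(\<lambda>i. ennreal (2 * C) * emeasure M (A i)) \<longlonglongrightarrow> ennreal (2 * C) * 0"
      using A(3) by (intro ennreal_tendsto_cmult) auto
    then have lim0: "(\<lambda>i. ennreal (2 * C) * emeasure M (A i)) \<longlonglongrightarrow> 0" by simp
    show "(\<lambda>i. N (A i)) \<longlonglongrightarrow> 0"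
      by (rule tendsto_sandwich[OF _ _ tendsto_const lim0]) (use A Nle in auto)
  qed
  define K where "K = measure_of (space M) (sets M) N"
  have Ks: "sets K = sets M" and Ksp: "space K = space M"
    by (simp_all add: K_def sets.sigma_sets_eq sets.space_closed)
  have K: "emeasure K A = N A" if "A \<in> sets M" for A
    using that pos ca unfolding K_def
    by (intro emeasure_measure_of_sigma sets.sigma_algebra_axioms) auto
  have "\<exists>f\<in>borel_measurable M. density M f = K"
  proof (rule Radon_Nikodym_finite_measure)
    show "finite_measure K" by (rule finite_measureI) (simp add: K Ksp N_def)
    show "absolutely_continuous M K"
      unfolding absolutely_continuous_def null_sets_def using Nle by (force simp: Ks K)
  qed (rule Ks)
  then obtain f where f: "f \<in> borel_measurable M" and fd: "density M f = K" by blast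
  have fN: "(\<integral>\<^sup>+x. f x * indicator A x \<partial>M) = N A" if "A \<in> sets M" for A
    using emeasure_density[OF f that] K[OF that] fd by simp
  have fle: "AE x in M. f x \<le> ennreal (2 * C)"
  proof (rule AE_upper_bound_inf_ennreal)
    fix e :: real assume e: "e > 0"
    \<comment> \<open>On this set the density exceeds 2C by e, so its integral is at least (2C + e)
      times the measure, while domination allows only 2C times; the set is null.\<close>
    define A where "A = {x\<in>space M. ennreal (2 * C) + ennreal e \<le> f x}"
    have A: "A \<in> sets M" using f unfolding A_def by measurable
    have "ennreal (2 * C + e) * emeasure M A = (\<integral>\<^sup>+x. ennreal (2 * C + e) * indicator A x \<partial>M)"
      by (rule nn_integral_cmult_indicator[OF A, symmetric])
    also have "\<dots> \<le> (\<integral>\<^sup>+x. f x * indicator A x \<partial>M)"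
      using C0 e by (intro nn_integral_mono) (auto simp: A_def indicator_def)
    also have "\<dots> \<le> ennreal (2 * C) * emeasure M A" using fN[OF A] Nle[OF A] by simp
    finally have "ennreal ((2 * C + e) * measure M A) \<le> ennreal (2 * C * measure M A)"
      using C0 e by (simp only: emeasure_eq_measure ennreal_mult''[OF measure_nonneg])
    then have "e * measure M A \<le> 0"
      using C0 by (subst (asm) ennreal_le_iff) (simp_all add: algebra_simps)
    then have "measure M A = 0" using e measure_nonneg[of M A] by (simp add: mult_le_0_iff)
    then have "emeasure M A = 0" by (simp add: emeasure_eq_measure)
    then have "A \<in> null_sets M" using A by auto
    then have "AE x in M. x \<notin> A" by (rule AE_not_in)
    then show "AE x in M. f x \<le> ennreal (2 * C) + ennreal e"
      using AE_space by eventually_elim (auto simp: A_def)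
  qed
  \<comment> \<open>The truncation makes the bounds hold at every point and changes f only on a null
    set.\<close>
  define h where "h x = min (enn2real (f x)) (2 * C)" for x
  have h: "h \<in> borel_measurable M" using f unfolding h_def by measurable
  have h0: "0 \<le> h x" "h x \<le> 2 * C" for x using C0 by (auto simp: h_def)
  have hf: "AE x in M. ennreal (h x) = f x"
    using fle
  proof eventually_elim
    case (elim x)
    then have "f x < top" by (rule le_less_trans) simp
    moreover have "enn2real (f x) \<le> 2 * C" using elim C0 by (simp add: enn2real_leI)
    ultimately show ?case by (simp add: h_def)
  qed
  show thesis
  proof (rule that)
    show "(\<lambda>x. h x - C) \<in> borel_measurable M" using h by measurable
    show "\<bar>h x - C\<bar> \<le> C" for x using h0[of x] by linarith
    fix A assume A: "A \<in> sets M"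
    have hi: "integrable M (\<lambda>x. h x * indicator A x)"
      using h A h0 C0 by (intro integrable_const_bound[where B="2 * C"]) (auto simp: indicator_def)
    have "ennreal (\<integral>x. h x * indicator A x \<partial>M) = (\<integral>\<^sup>+x. ennreal (h x * indicator A x) \<partial>M)"
      using h0 by (intro nn_integral_eq_integral[symmetric] hi) auto
    also have "\<dots> = (\<integral>\<^sup>+x. f x * indicator A x \<partial>M)"
      using hf by (intro nn_integral_cong_AE) (auto elim!: eventually_mono simp: indicator_def)
    also have "\<dots> = N A" by (rule fN[OF A])
    finally have "(\<integral>x. h x * indicator A x \<partial>M) = l (indicator A) + C * measure M A"
      using nn[OF A] h0 unfolding N_def by (subst (asm) ennreal_inj) (auto intro!: integral_nonneg_AE)
    moreover have "(\<integral>x. (h x - C) * indicator A x \<partial>M) = (\<integral>x. h x * indicator A x \<partial>M) - C * measure M A"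
      using hi A by (simp add: left_diff_distrib)
    ultimately show "l (indicator A) = (\<integral>x. (h x - C) * indicator A x \<partial>M)" by simp
  qed
qed

lemma integrable_bounded_mult:
  fixes g :: "'a \<Rightarrow> real" and f :: "'a \<Rightarrow> 'b::{banach, second_countable_topology}"
  assumes f: "integrable M f" and g: "g \<in> borel_measurable M" "\<And>x. \<bar>g x\<bar> \<le> C"
  shows "integrable M (\<lambda>x. g x *\<^sub>R f x)"
proof (rule Bochner_Integration.integrable_bound)
  show "integrable M (\<lambda>x. C *\<^sub>R f x)" using f by simp
  show "AE x in M. norm (g x *\<^sub>R f x) \<le> norm (C *\<^sub>R f x)"
  proof (rule AE_I2)
    fix x
    have "\<bar>g x\<bar> \<le> \<bar>C\<bar>" using g(2)[of x] by linarith
    then show "norm (g x *\<^sub>R f x) \<le> norm (C *\<^sub>R f x)" by (simp add: mult_right_mono)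
  qed
qed (use f g in measurable)

text \<open>Both sides are linear, agree on indicators and are continuous along the dominated
  approximations by simple functions: the left by the bound on l, the right because g is
  bounded.\<close>

theorem L1_dual_representation_real:
  fixes l :: "('a \<Rightarrow> real) \<Rightarrow> real"
  assumes "finite_measure M" and C0: "C \<ge> 0"
    and l: "linear_functional_on {f. integrable M f} l"
    and bound: "\<And>f. integrable M f \<Longrightarrow> \<bar>l f\<bar> \<le> C * (\<integral>x. \<bar>f x\<bar> \<partial>M)"
  obtains g where "g \<in> borel_measurable M" "\<And>x. \<bar>g x\<bar> \<le> C"
    "\<And>f. integrable M f \<Longrightarrow> l f = (\<integral>x. g x * f x \<partial>M)"
proof -
  interpret finite_measure M by fact
  obtain g where g: "g \<in> borel_measurable M" "\<And>x. \<bar>g x\<bar> \<le> C"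
    and gi: "\<And>A. A \<in> sets M \<Longrightarrow> l (indicator A) = (\<integral>x. g x * indicator A x \<partial>M)"
    using bounded_density_of_functional[OF assms] by blast
  have gf: "integrable M (\<lambda>x. g x * f x)" if "integrable M f" for f :: "'a \<Rightarrow> real"
    using integrable_bounded_mult[OF that g] by simp
  have ladd: "l (\<lambda>x. u x + v x) = l u + l v" if "integrable M u" "integrable M v" for u v
    using l that unfolding linear_functional_on_def by auto
  have lsc: "l (\<lambda>x. c * u x) = c * l u" if "integrable M u" for u c
    using l that by (simp add: linear_functional_on_def)
  have "l f = (\<integral>x. g x * f x \<partial>M)" if "integrable M f" for f
    using that
  proof (induction rule: integrable_induct)
    case (base A c)
    have A: "integrable M (indicator A :: _ \<Rightarrow> real)" using base by simp
    have "l (\<lambda>x. c * indicator A x) = c * (\<integral>x. g x * indicator A x \<partial>M)"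
      using lsc[OF A] gi base by simp
    then show ?case by (simp add: mult.commute mult.left_commute)
  next
    case (add f1 f2)
    then show ?case using ladd[of f1 f2] gf by (simp add: distrib_left)
  next
    case (lim f s)
    have d: "(\<lambda>i. \<integral>x. \<bar>s i x - f x\<bar> \<partial>M) \<longlonglongrightarrow> (\<integral>x. 0 \<partial>M)"
    \<comment> \<open>The approximating functions satisfy |s i x| \<le> 2 |f x|, so the differences
      are dominated by 3 |f x|.\<close>
    proof (rule integral_dominated_convergence[where w="\<lambda>x. 3 * \<bar>f x\<bar>"])
      show "AE x in M. (\<lambda>i. \<bar>s i x - f x\<bar>) \<longlonglongrightarrow> 0"
        using lim(2) by (intro AE_I2 tendsto_rabs_zero) (simp add: LIM_zero_iff)
      show "AE x in M. norm \<bar>s i x - f x\<bar> \<le> 3 * \<bar>f x\<bar>" for i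
      proof (rule AE_I2)
        fix x assume "x \<in> space M"
        with lim(3)[of x i] show "norm \<bar>s i x - f x\<bar> \<le> 3 * \<bar>f x\<bar>" by simp
      qed
    qed (use lim in auto)
    have bs: "\<bar>l (s i) - l f\<bar> \<le> C * (\<integral>x. \<bar>s i x - f x\<bar> \<partial>M)" for i
    proof -
      have "l (\<lambda>x. s i x + (-1) * f x) = l (s i) + (-1) * l f"
        using lim ladd[of "s i" "\<lambda>x. (-1) * f x"] lsc[of f "-1"] by simp
      then have "l (\<lambda>x. s i x - f x) = l (s i) - l f" by simp
      then show ?thesis using bound[of "\<lambda>x. s i x - f x"] lim by simp
    qed
    have "(\<lambda>i. l (s i) - l f) \<longlonglongrightarrow> 0"
      by (rule Lim_null_comparison[OF always_eventually tendsto_mult_right_zero[OF d[simplified], of C]])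
         (use bs in auto)
    then have 1: "(\<lambda>i. l (s i)) \<longlonglongrightarrow> l f" by (simp add: LIM_zero_iff)
    have 2: "(\<lambda>i. \<integral>x. g x * s i x \<partial>M) \<longlonglongrightarrow> (\<integral>x. g x * f x \<partial>M)"
    proof (rule integral_dominated_convergence[where w="\<lambda>x. C * (2 * \<bar>f x\<bar>)"])
      show "AE x in M. (\<lambda>i. g x * s i x) \<longlonglongrightarrow> g x * f x"
        using lim(2) by (intro AE_I2 tendsto_mult_left) auto
      show "AE x in M. norm (g x * s i x) \<le> C * (2 * \<bar>f x\<bar>)" for i
      proof (rule AE_I2)
        fix x assume "x \<in> space M"
        with lim(3)[of x i] show "norm (g x * s i x) \<le> C * (2 * \<bar>f x\<bar>)"
          using g(2)[of x] C0 by (simp add: abs_mult mult_mono)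
      qed
    qed (use lim g in auto)
    show ?case using LIMSEQ_unique[OF 1] 2 lim by simp
  qed
  with g show thesis by (rule that)
qed

text \<open>The scalar representation is applied along each basis vector. Summing the coordinate
  bounds gives the crude constant DIM * C; only boundedness matters later, hence the unspecified
  K.\<close>

theorem L1_dual_representation:
  fixes l :: "('a \<Rightarrow> 'b::euclidean_space) \<Rightarrow> real"
  assumes fin: "finite_measure M" and C0: "C \<ge> 0"
    and l: "linear_functional_on {f. integrable M f} l"
    and bound: "\<And>f. integrable M f \<Longrightarrow> \<bar>l f\<bar> \<le> C * (\<integral>x. norm (f x) \<partial>M)"
  obtains g K where "g \<in> borel_measurable M" "\<And>x. norm (g x) \<le> K"
    "\<And>f. integrable M f \<Longrightarrow> l f = (\<integral>x. g x \<bullet> f x \<partial>M)"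
proof -
  have ladd: "l (\<lambda>x. u x + v x) = l u + l v" if "integrable M u" "integrable M v" for u v
    using l that by (simp add: linear_functional_on_def)
  have lsc: "l (\<lambda>x. c *\<^sub>R u x) = c * l u" if "integrable M u" for u c
    using l that by (simp add: linear_functional_on_def)
  have "\<forall>b\<in>Basis. \<exists>g. g \<in> borel_measurable M \<and> (\<forall>x. \<bar>g x\<bar> \<le> C) \<and>
      (\<forall>u. integrable M u \<longrightarrow> l (\<lambda>x. u x *\<^sub>R b) = (\<integral>x. g x * u x \<partial>M))"
  proof
    fix b :: 'b assume b: "b \<in> Basis"
    have "linear_functional_on {u. integrable M u} (\<lambda>u. l (\<lambda>x. u x *\<^sub>R b))"
      using ladd[of "\<lambda>x. _ x *\<^sub>R b" "\<lambda>x. _ x *\<^sub>R b"] lsc[of "\<lambda>x. _ x *\<^sub>R b"]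
      by (simp add: linear_functional_on_def scaleR_add_left)
    moreover have "\<bar>l (\<lambda>x. u x *\<^sub>R b)\<bar> \<le> C * (\<integral>x. \<bar>u x\<bar> \<partial>M)" if "integrable M u" for u
      using bound[of "\<lambda>x. u x *\<^sub>R b"] that b by simp
    ultimately show "\<exists>g. g \<in> borel_measurable M \<and> (\<forall>x. \<bar>g x\<bar> \<le> C) \<and>
      (\<forall>u. integrable M u \<longrightarrow> l (\<lambda>x. u x *\<^sub>R b) = (\<integral>x. g x * u x \<partial>M))" (is ?th)
    proof (rule L1_dual_representation_real[OF fin C0])
      fix g assume "g \<in> borel_measurable M" "\<And>x. \<bar>g x\<bar> \<le> C"
        "\<And>u. integrable M u \<Longrightarrow> l (\<lambda>x. u x *\<^sub>R b) = (\<integral>x. g x * u x \<partial>M)"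
      then show ?th by (intro exI[of _ g]) simp
    qed
  qed
  from bchoice[OF this] obtain g where g: "\<And>b. b \<in> Basis \<Longrightarrow> g b \<in> borel_measurable M"
      "\<And>b x. b \<in> Basis \<Longrightarrow> \<bar>g b x\<bar> \<le> C"
      "\<And>b u. b \<in> Basis \<Longrightarrow> integrable M u \<Longrightarrow> l (\<lambda>x. u x *\<^sub>R b) = (\<integral>x. g b x * u x \<partial>M)"
    by auto
  define G where "G x = (\<Sum>b\<in>Basis. g b x *\<^sub>R b)" for x
  have l0: "l (\<lambda>_. 0) = 0" using lsc[of "\<lambda>_. 0" 0] by simp
  have lsum: "l (\<lambda>x. \<Sum>b\<in>B. u b x) = (\<Sum>b\<in>B. l (u b))"
    if "finite B" "\<And>b. b \<in> B \<Longrightarrow> integrable M (u b)" for B :: "'b set" and u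
    using that by (induction rule: finite_induct) (simp_all add: l0 ladd)
  show thesis
  proof (rule that)
    show "G \<in> borel_measurable M" unfolding G_def using g(1) by measurable
    show "norm (G x) \<le> real DIM('b) * C" for x
    proof -
      have "norm (G x) \<le> (\<Sum>b\<in>(Basis :: 'b set). C)"
        unfolding G_def by (rule order_trans[OF norm_sum sum_mono]) (use g(2) in simp)
      then show ?thesis by simp
    qed
    fix f :: "'a \<Rightarrow> 'b" assume f: "integrable M f"
    have fb: "integrable M (\<lambda>x. f x \<bullet> b)" for b using f by simp
    have "l f = l (\<lambda>x. \<Sum>b\<in>Basis. (f x \<bullet> b) *\<^sub>R b)" by (simp add: euclidean_representation)
    also have "\<dots> = (\<Sum>b\<in>Basis. l (\<lambda>x. (f x \<bullet> b) *\<^sub>R b))" using fb by (intro lsum) auto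
    also have "\<dots> = (\<Sum>b\<in>Basis. \<integral>x. g b x * (f x \<bullet> b) \<partial>M)" using g(3) fb by simp
    also have "\<dots> = (\<integral>x. (\<Sum>b\<in>Basis. g b x * (f x \<bullet> b)) \<partial>M)"
      using integrable_bounded_mult[OF fb g(1,2)] by (intro Bochner_Integration.integral_sum[symmetric]) auto
    also have "\<dots> = (\<integral>x. G x \<bullet> f x \<partial>M)"
      by (simp add: G_def inner_sum_left inner_commute[of "f _"])
    finally show "l f = (\<integral>x. G x \<bullet> f x \<partial>M)" .
  qed
qed

text \<open>The directional derivative of \<open>h\<close> at \<open>0\<close> is sublinear, and a linear functional below it
  is a subgradient.\<close>

theorem L1_subgradient:
  fixes h :: "('a \<Rightarrow> 'b::euclidean_space) \<Rightarrow> real"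
  assumes fin: "finite_measure M" and L: "L \<ge> 0"
    and convex: "\<And>p q s t. integrable M p \<Longrightarrow> integrable M q \<Longrightarrow> 0 < s \<Longrightarrow> 0 < t \<Longrightarrow> s + t = 1 \<Longrightarrow>
      h (\<lambda>x. s *\<^sub>R p x + t *\<^sub>R q x) \<le> s * h p + t * h q"
    and lip: "\<And>p. integrable M p \<Longrightarrow> \<bar>h p - h (\<lambda>_. 0)\<bar> \<le> L * (\<integral>x. norm (p x) \<partial>M)"
  obtains \<sigma> K where "\<sigma> \<in> borel_measurable M" "\<And>x. norm (\<sigma> x) \<le> K"
    "\<And>p. integrable M p \<Longrightarrow> (\<integral>x. \<sigma> x \<bullet> p x \<partial>M) \<le> h p - h (\<lambda>_. 0)"
proof -
  let ?V = "{p :: 'a \<Rightarrow> 'b. integrable M p}"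
  define k where "k p = h p - h (\<lambda>_. 0)" for p
  \<comment> \<open>For convex h the difference quotients increase with t, so this infimum is the
    one-sided directional derivative at 0. The infimum form needs no limits.\<close>
  define P where "P p = (INF t\<in>{0<..}. k (\<lambda>x. t *\<^sub>R p x) / t)" for p
  have lower: "- (L * (\<integral>x. norm (p x) \<partial>M)) \<le> k (\<lambda>x. t *\<^sub>R p x) / t" if "integrable M p" "t > 0" for p t
  proof -
    have "\<bar>k (\<lambda>x. t *\<^sub>R p x)\<bar> \<le> L * (\<integral>x. norm (t *\<^sub>R p x) \<partial>M)"
      unfolding k_def using that by (intro lip) simp
    also have "\<dots> = t * (L * (\<integral>x. norm (p x) \<partial>M))" using that by simp
    finally show ?thesis using that by (simp add: field_simps abs_le_iff)
  qed
  have bdd: "bdd_below ((\<lambda>t. k (\<lambda>x. t *\<^sub>R p x) / t) ` {0<..})" if "integrable M p" for p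
    by (rule bdd_belowI2) (use lower[OF that] in auto)
  have kc: "k (\<lambda>x. s *\<^sub>R p x + t *\<^sub>R q x) \<le> s * k p + t * k q"
    if "integrable M p" "integrable M q" "0 < s" "0 < t" "s + t = 1" for p q s t
  proof -
    have "h (\<lambda>_. 0) = s * h (\<lambda>_. 0) + t * h (\<lambda>_. 0)" using that by (simp flip: distrib_right)
    then show ?thesis using convex[OF that] by (simp add: k_def algebra_simps)
  qed
  have "sublinear_on ?V P"
    unfolding sublinear_on_def
  proof (intro conjI ballI allI impI)
    fix u v assume "u \<in> ?V" "v \<in> ?V"
    then have u: "integrable M u" and v: "integrable M v" by auto
    have "P (\<lambda>x. u x + v x) \<le> 1 * P u + 1 * P v"
      unfolding P_def
    proof (rule cINF_le_weighted_add)
      fix s t :: real assume "s \<in> {0<..}" "t \<in> {0<..}"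
      then have st: "s > 0" "t > 0" by auto
      \<comment> \<open>Chosen so that w / s + w / t = 1: then w (u + v) is the convex combination
        of s u and t v with weights w / s = t / (s + t) and w / t = s / (s + t).\<close>
      define w where "w = s * t / (s + t)"
      have w: "w > 0" using st by (simp add: w_def)
      have "k (\<lambda>x. w *\<^sub>R (u x + v x)) = k (\<lambda>x. (t / (s + t)) *\<^sub>R (s *\<^sub>R u x) + (s / (s + t)) *\<^sub>R (t *\<^sub>R v x))"
        by (simp add: w_def scaleR_add_right mult.commute)
      also have "\<dots> \<le> t / (s + t) * k (\<lambda>x. s *\<^sub>R u x) + s / (s + t) * k (\<lambda>x. t *\<^sub>R v x)"
      proof (rule kc)
        have "s + t \<noteq> 0" using st by simp
        then show "t / (s + t) + s / (s + t) = 1"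
          by (simp add: add_divide_distrib[symmetric] add.commute)
      qed (use st u v in auto)
      also have "\<dots> = w * (k (\<lambda>x. s *\<^sub>R u x) / s + k (\<lambda>x. t *\<^sub>R v x) / t)"
      proof -
        have "t / (s + t) = w / s" "s / (s + t) = w / t" using st by (simp_all add: w_def)
        then show ?thesis by (simp add: distrib_left)
      qed
      finally show "\<exists>w\<in>{0<..}. k (\<lambda>x. w *\<^sub>R (u x + v x)) / w
          \<le> 1 * (k (\<lambda>x. s *\<^sub>R u x) / s) + 1 * (k (\<lambda>x. t *\<^sub>R v x) / t)"
        using w by (intro bexI[of _ w]) (auto simp: field_simps)
    qed (use bdd u v in auto)
    then show "P (\<lambda>x. u x + v x) \<le> P u + P v" by simp
  next
    fix u and c :: real assume "u \<in> ?V" and c: "0 < c"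
    then have u: "integrable M u" by simp
    have "P (\<lambda>x. c *\<^sub>R u x) / c \<le> P u"
      unfolding P_def[of u]
    proof (rule cINF_greatest)
      fix s :: real assume s: "s \<in> {0<..}"
      have "P (\<lambda>x. c *\<^sub>R u x) \<le> k (\<lambda>x. (s / c) *\<^sub>R (c *\<^sub>R u x)) / (s / c)"
        unfolding P_def by (rule cINF_lower[OF bdd]) (use s c u in auto)
      then show "P (\<lambda>x. c *\<^sub>R u x) / c \<le> k (\<lambda>x. s *\<^sub>R u x) / s"
        using c s by (simp add: field_simps)
    qed auto
    then show "P (\<lambda>x. c *\<^sub>R u x) \<le> c * P u" using c by (simp add: field_simps)
  qed
  then obtain l where l: "linear_functional_on ?V l" and "\<And>p. p \<in> ?V \<Longrightarrow> l p \<le> P p"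
    using Hahn_Banach_functions[OF function_subspace_integrable] by blast
  then have lP: "l p \<le> P p" if "integrable M p" for p using that by simp
  \<comment> \<open>The competitor t = 1 in the infimum turns the bound by the directional
    derivative into the subgradient inequality.\<close>
  have lk: "l p \<le> k p" if "integrable M p" for p
    using lP[OF that] cINF_lower[OF bdd[OF that], of 1] by (simp add: P_def)
  have lb: "l p \<le> L * (\<integral>x. norm (p x) \<partial>M)" if "integrable M p" for p
    using lk[OF that] lip[OF that] by (simp add: k_def abs_le_iff)
  have bound: "\<bar>l p\<bar> \<le> L * (\<integral>x. norm (p x) \<partial>M)" if "integrable M p" for p
  proof -
    have "l (\<lambda>x. (-1) *\<^sub>R p x) = (-1) * l p"
      using l that unfolding linear_functional_on_def mem_Collect_eq by blast
    then show ?thesis using lb[OF that] lb[of "\<lambda>x. - p x"] that by simp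
  qed
  show thesis
  proof (rule L1_dual_representation[OF fin L l bound])
    fix g K assume g: "g \<in> borel_measurable M" "\<And>x. norm (g x) \<le> K"
      "\<And>f. integrable M f \<Longrightarrow> l f = (\<integral>x. g x \<bullet> f x \<partial>M)"
    show thesis
      by (rule that[OF g(1,2)]) (use g(3) lk in \<open>auto simp: k_def\<close>)
  qed
qed

subsection \<open>Test functions and uniqueness of weak gradients\<close>

text \<open>The case m = 0 is the classical smooth function exp(-1/t) extended by zero. The powers
  of 1/t are included because differentiation produces them.\<close>

definition exp_bump :: "nat \<Rightarrow> real \<Rightarrow> real" where
  "exp_bump m t = (if t > 0 then inverse t ^ m * exp (- inverse t) else 0)"

lemma exp_bump_tendsto_0: "(exp_bump m \<longlongrightarrow> 0) (at 0)"
proof -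
  have "((\<lambda>t. inverse t ^ m / exp (inverse t)) \<longlongrightarrow> 0) (at_right (0::real))"
    by (rule filterlim_compose[OF tendsto_power_div_exp_0 filterlim_inverse_at_top_right])
  then have "(exp_bump m \<longlongrightarrow> 0) (at_right 0)"
    by (rule tendsto_cong[THEN iffD1, rotated])
       (auto simp: exp_bump_def eventually_at_filter exp_minus divide_inverse)
  moreover have "(exp_bump m \<longlongrightarrow> 0) (at_left 0)"
    by (rule tendsto_eventually) (auto simp: exp_bump_def eventually_at_filter)
  ultimately show ?thesis by (simp add: filterlim_split_at)
qed

text \<open>Differentiating only raises the index, so the family is closed under derivatives. At t =
  0 the difference quotient of \<open>exp_bump m\<close> is \<open>exp_bump (m + 1)\<close>, which
  tends to 0.\<close>

lemma exp_bump_has_derivative: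
  "(exp_bump m has_real_derivative (exp_bump (m + 2) t - real m * exp_bump (m + 1) t)) (at t)"
proof -
  consider "t > 0" | "t = 0" | "t < 0" by linarith
  then show ?thesis
  proof cases
    case 1
    have "((\<lambda>t. inverse t ^ m) has_real_derivative (- real m * inverse t ^ (m + 1))) (at t)"
    proof (induction m)
      case (Suc m)
      show ?case
        using DERIV_cong[OF DERIV_mult[OF DERIV_inverse Suc]] 1 by (simp add: algebra_simps)
    qed simp
    moreover have "((\<lambda>t. exp (- inverse t)) has_real_derivative exp (- inverse t) * (inverse t * inverse t)) (at t)"
      using 1 by (auto intro!: derivative_eq_intros)
    ultimately have "((\<lambda>t. inverse t ^ m * exp (- inverse t)) has_real_derivative
        (exp_bump (m + 2) t - real m * exp_bump (m + 1) t)) (at t)"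
      by (rule DERIV_cong[OF DERIV_mult]) (use 1 in \<open>simp add: exp_bump_def algebra_simps\<close>)
    then show ?thesis
      by (rule has_field_derivative_transform_within_open[where S="{0<..}"])
         (use 1 in \<open>auto simp: exp_bump_def\<close>)
  next
    case 2
    have "((\<lambda>h. exp_bump m h / h) \<longlongrightarrow> 0) (at 0)"
      by (rule tendsto_cong[THEN iffD1, OF _ exp_bump_tendsto_0[of "m + 1"]])
         (auto simp: exp_bump_def eventually_at_filter divide_inverse)
    then have "(exp_bump m has_real_derivative 0) (at 0)"
      by (simp add: has_field_derivative_iff exp_bump_def[of _ 0])
    then show ?thesis using 2 by (simp add: exp_bump_def)
  next
    case 3
    have "((\<lambda>t. 0) has_real_derivative 0) (at t)" by simp
    then have "(exp_bump m has_real_derivative 0) (at t)"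
      by (rule has_field_derivative_transform_within_open[where S="{..<0}"])
         (use 3 in \<open>auto simp: exp_bump_def\<close>)
    then show ?thesis using 3 by (simp add: exp_bump_def)
  qed
qed

text \<open>This algebra is closed under partial derivatives, so all its members are smooth.\<close>

inductive_set bump_algebra :: "(real^'n \<Rightarrow> real) set" where
  const: "(\<lambda>x. c) \<in> bump_algebra"
| bump: "(\<lambda>x. exp_bump m (c * x $ i + d)) \<in> bump_algebra"
| add: "\<phi> \<in> bump_algebra \<Longrightarrow> \<psi> \<in> bump_algebra \<Longrightarrow> (\<lambda>x. \<phi> x + \<psi> x) \<in> bump_algebra"
| mult: "\<phi> \<in> bump_algebra \<Longrightarrow> \<psi> \<in> bump_algebra \<Longrightarrow> (\<lambda>x. \<phi> x * \<psi> x) \<in> bump_algebra"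

lemma bump_algebra_derivative:
  fixes \<phi> :: "real^'n \<Rightarrow> real"
  assumes "\<phi> \<in> bump_algebra"
  shows "\<exists>\<phi>'. (\<forall>x. (\<phi> has_derivative \<phi>' x) (at x)) \<and> (\<forall>j. (\<lambda>x. \<phi>' x (axis j 1)) \<in> bump_algebra)"
  using assms
proof induction
  case (const c)
  show ?case by (rule exI[of _ "\<lambda>x h. 0"]) (auto intro: bump_algebra.const)
next
  case (bump m c i d)
  let ?e = "\<lambda>t. exp_bump (m + 2) t + (- real m) * exp_bump (m + 1) t"
  show ?case
  proof (intro exI conjI allI)
    fix x :: "real^'n"
    have "((\<lambda>x. c * x $ i + d) has_derivative (\<lambda>h. c * h $ i)) (at x)"
      by (auto intro!: derivative_eq_intros bounded_linear_imp_has_derivative[OF bounded_linear_vec_nth])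
    from has_derivative_compose[OF this exp_bump_has_derivative[unfolded has_field_derivative_def]]
    show "((\<lambda>x. exp_bump m (c * x $ i + d)) has_derivative (\<lambda>h. (c * h $ i) * ?e (c * x $ i + d))) (at x)"
      by (simp add: mult.commute)
  next
    fix j
    show "(\<lambda>x. (c * axis j 1 $ i) * ?e (c * x $ i + d)) \<in> bump_algebra"
      by (intro bump_algebra.intros)
  qed
next
  case (add \<phi> \<psi>)
  then obtain \<phi>' \<psi>' where d: "\<And>x. (\<phi> has_derivative \<phi>' x) (at x)" "\<And>x. (\<psi> has_derivative \<psi>' x) (at x)"
    and "\<And>j. (\<lambda>x. \<phi>' x (axis j 1)) \<in> bump_algebra" "\<And>j. (\<lambda>x. \<psi>' x (axis j 1)) \<in> bump_algebra"
    by blast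
  then show ?case
    by (intro exI[of _ "\<lambda>x h. \<phi>' x h + \<psi>' x h"]) (simp add: has_derivative_add bump_algebra.add)
next
  case (mult \<phi> \<psi>)
  then obtain \<phi>' \<psi>' where d: "\<And>x. (\<phi> has_derivative \<phi>' x) (at x)" "\<And>x. (\<psi> has_derivative \<psi>' x) (at x)"
    and "\<And>j. (\<lambda>x. \<phi>' x (axis j 1)) \<in> bump_algebra" "\<And>j. (\<lambda>x. \<psi>' x (axis j 1)) \<in> bump_algebra"
    by blast
  then show ?case using mult.hyps
    by (intro exI[of _ "\<lambda>x h. \<phi> x * \<psi>' x h + \<phi>' x h * \<psi> x"])
      (simp add: has_derivative_mult bump_algebra.add bump_algebra.mult)
qed

lemma bump_algebra_iter_pderiv:
  "\<phi> \<in> bump_algebra \<Longrightarrow> iter_pderiv js \<phi> \<in> bump_algebra"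
proof (induction js)
  case (Cons j js)
  from bump_algebra_derivative[OF Cons.IH[OF Cons.prems]] obtain \<phi>' where
    d: "\<And>x. (iter_pderiv js \<phi> has_derivative \<phi>' x) (at x)" and "(\<lambda>x. \<phi>' x (axis j 1)) \<in> bump_algebra"
    by blast
  moreover have "iter_pderiv (j # js) \<phi> = (\<lambda>x. \<phi>' x (axis j 1))"
    by (simp add: fun_eq_iff pderiv_def frechet_derivative_at[OF d, symmetric])
  ultimately show ?case by simp
qed simp

lemma bump_algebra_smooth: "\<phi> \<in> bump_algebra \<Longrightarrow> smooth_fun \<phi>"
  unfolding smooth_fun_def differentiable_def
  using bump_algebra_derivative[OF bump_algebra_iter_pderiv, of \<phi>] by fast

lemma bump_algebra_prod:
  "finite I \<Longrightarrow> (\<And>i. i \<in> I \<Longrightarrow> \<phi> i \<in> bump_algebra) \<Longrightarrow> (\<lambda>x. \<Prod>i\<in>I. \<phi> i x) \<in> bump_algebra"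
  by (induction rule: finite_induct) (auto intro: bump_algebra.const bump_algebra.mult)

text \<open>Each factor is a bump in the distance to one face. Since exp(-1/(k t)) tends to 1 for
  every t > 0, these functions approach the indicator of the open box as k grows, staying below
  it.\<close>

definition box_bump :: "real^'n \<Rightarrow> real^'n \<Rightarrow> real \<Rightarrow> real^'n \<Rightarrow> real" where
  "box_bump a b k x = (\<Prod>i\<in>UNIV. exp_bump 0 (k * (x $ i - a $ i)) * exp_bump 0 (k * (b $ i - x $ i)))"

lemma exp_bump_0_bounds: "0 \<le> exp_bump 0 t" "exp_bump 0 t \<le> 1"
  by (auto simp: exp_bump_def)

lemma box_bump_bounds: "0 \<le> box_bump a b k x" "box_bump a b k x \<le> 1"
  unfolding box_bump_def
  by (auto intro!: prod_nonneg prod_le_1 mult_nonneg_nonneg mult_le_one exp_bump_0_bounds)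

lemma box_bump_nonzero_iff: "k > 0 \<Longrightarrow> box_bump a b k x \<noteq> 0 \<longleftrightarrow> x \<in> box a b"
proof -
  assume "k > 0"
  moreover have "exp_bump 0 t \<noteq> 0 \<longleftrightarrow> t > 0" for t by (simp add: exp_bump_def)
  ultimately show ?thesis
    by (simp add: box_bump_def mem_box_cart zero_less_mult_iff all_conj_distrib)
qed

lemma test_fun_box_bump:
  assumes "cbox a b \<subseteq> \<Omega>" "k > 0"
  shows "test_fun \<Omega> (box_bump a b k)"
proof -
  have "(\<lambda>x. \<Prod>i\<in>UNIV. exp_bump 0 (k * x $ i + - (k * a $ i)) * exp_bump 0 ((- k) * x $ i + k * b $ i))
      \<in> bump_algebra"
    by (intro bump_algebra_prod bump_algebra.intros) auto
  then have "box_bump a b k \<in> bump_algebra"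
    by (simp add: box_bump_def[abs_def] algebra_simps)
  then have "smooth_fun (box_bump a b k)" by (rule bump_algebra_smooth)
  moreover have sub: "closure {x. box_bump a b k x \<noteq> 0} \<subseteq> cbox a b"
    using box_subset_cbox[of a b] by (intro closure_minimal) (auto simp: box_bump_nonzero_iff[OF assms(2)])
  moreover have "compact (closure {x. box_bump a b k x \<noteq> 0})"
    using bounded_subset[OF bounded_cbox sub] by (simp add: compact_eq_bounded_closed)
  ultimately show ?thesis using assms(1) unfolding test_fun_def by blast
qed

lemma exp_bump_scale_tendsto:
  assumes "t > 0"
  shows "(\<lambda>k. exp_bump 0 (real (Suc k) * t)) \<longlonglongrightarrow> 1"
proof -
  have "(\<lambda>k. exp (- (inverse (real (Suc k)) * inverse t))) \<longlonglongrightarrow> exp (- (0 * inverse t))"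
    by (intro tendsto_intros LIMSEQ_inverse_real_of_nat)
  then show ?thesis using assms by (simp add: exp_bump_def zero_less_mult_iff del: of_nat_Suc)
qed

lemma box_bump_tendsto: "(\<lambda>k. box_bump a b (real (Suc k)) x) \<longlonglongrightarrow> indicator (box a b) x"
proof (cases "x \<in> box a b")
  case True
  have "(\<lambda>k. \<Prod>i\<in>UNIV. exp_bump 0 (real (Suc k) * (x $ i - a $ i)) * exp_bump 0 (real (Suc k) * (b $ i - x $ i)))
      \<longlonglongrightarrow> (\<Prod>i\<in>(UNIV::'a set). 1 * 1)"
    using True by (intro tendsto_prod tendsto_mult exp_bump_scale_tendsto) (auto simp: mem_box_cart)
  then show ?thesis using True by (simp add: box_bump_def)
next
  case False
  then have "box_bump a b (real (Suc k)) x = 0" for k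
    using box_bump_nonzero_iff[of "real (Suc k)" a b x] by simp
  then show ?thesis using False by simp
qed

section \<open>Bounds for test functions and the fundamental lemma\<close>

lemma smooth_fun_iter_pderiv_continuous:
  "smooth_fun \<phi> \<Longrightarrow> continuous_on UNIV (iter_pderiv js \<phi>)"
  unfolding smooth_fun_def
  by (intro continuous_at_imp_continuous_on ballI differentiable_imp_continuous_within) auto

lemma test_fun_continuous: "test_fun \<Omega> \<phi> \<Longrightarrow> continuous_on UNIV \<phi>"
  using smooth_fun_iter_pderiv_continuous[of \<phi> "[]"] by (simp add: test_fun_def)

lemma test_fun_pderiv_continuous: "test_fun \<Omega> \<phi> \<Longrightarrow> continuous_on UNIV (pderiv j \<phi>)"
  using smooth_fun_iter_pderiv_continuous[of \<phi> "[j]"] by (simp add: test_fun_def)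

lemma continuous_compact_support_bounded:
  fixes u :: "'a::topological_space \<Rightarrow> real"
  assumes "continuous_on UNIV u" "compact K" "\<And>x. x \<notin> K \<Longrightarrow> u x = 0"
  obtains C where "\<And>x. \<bar>u x\<bar> \<le> C"
proof -
  have "bounded (u ` K)"
    using assms by (intro compact_imp_bounded compact_continuous_image) (auto intro: continuous_on_subset)
  then obtain C where "\<And>x. x \<in> K \<Longrightarrow> \<bar>u x\<bar> \<le> C" unfolding bounded_iff by auto
  then have "\<bar>u x\<bar> \<le> max C 0" for x
    using assms(3)[of x] by (cases "x \<in> K") (auto simp: le_max_iff_disj)
  then show thesis by (rule that)
qed

lemma test_fun_bounded:
  assumes "test_fun \<Omega> \<phi>"
  obtains C where "\<And>x. \<bar>\<phi> x\<bar> \<le> C"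
proof (rule continuous_compact_support_bounded[OF test_fun_continuous[OF assms]])
  show "compact (closure {x. \<phi> x \<noteq> 0})" using assms by (simp add: test_fun_def)
  show "\<phi> x = 0" if "x \<notin> closure {x. \<phi> x \<noteq> 0}" for x
    using that closure_subset[of "{x. \<phi> x \<noteq> 0}"] by auto
qed (rule that)

text \<open>The complement of the closed support is open and \<phi> vanishes on it, so the
  derivative vanishes there too; on the compact support it is bounded by continuity.\<close>

lemma test_fun_pderiv_bounded:
  assumes "test_fun \<Omega> \<phi>"
  obtains C where "\<And>x. \<bar>pderiv j \<phi> x\<bar> \<le> C"
proof (rule continuous_compact_support_bounded[OF test_fun_pderiv_continuous[OF assms]])
  let ?K = "closure {x. \<phi> x \<noteq> 0}"
  show "compact ?K" using assms by (simp add: test_fun_def)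
  fix x assume "x \<notin> ?K"
  then have x: "x \<in> - ?K" by simp
  have "(\<phi> has_derivative (\<lambda>_. 0)) (at x)"
  proof (rule has_derivative_transform_within_open[OF has_derivative_const[of 0] _ x])
    show "0 = \<phi> y" if "y \<in> - ?K" for y
    proof (rule ccontr)
      assume "0 \<noteq> \<phi> y"
      then have "y \<in> ?K" using closure_subset[of "{x. \<phi> x \<noteq> 0}"] by auto
      with that show False by simp
    qed
  qed auto
  from frechet_derivative_at[OF this, symmetric] show "pderiv j \<phi> x = 0" by (simp add: pderiv_def)
qed (rule that)

text \<open>The positive and negative parts of h are the densities of two measures that agree on all
  open boxes. Boxes form an intersection-stable generator of the Borel sets, so the measures
  coincide, and by uniqueness of densities the two parts are equal almost everywhere, hence both
  zero.\<close>

lemma AE_zero_if_box_integrals_zero_lborel: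
  fixes h :: "'a::euclidean_space \<Rightarrow> real"
  assumes h: "integrable lborel h"
    and zero: "\<And>a b. (\<integral>x. h x * indicator (box a b) x \<partial>lborel) = 0"
  shows "AE x in lborel. h x = 0"
proof -
  let ?P = "density lborel (\<lambda>x. ennreal (h x))" and ?N = "density lborel (\<lambda>x. ennreal (- h x))"
  have [measurable]: "h \<in> borel_measurable borel" using h by auto
  have fin: "(\<integral>\<^sup>+x. ennreal (h x) \<partial>lborel) \<noteq> \<infinity>" using h by (simp add: real_integrable_def)
  have eP: "emeasure ?P (box a b) = (\<integral>\<^sup>+x. ennreal (h x * indicator (box a b) x) \<partial>lborel)"
    and eN: "emeasure ?N (box a b) = (\<integral>\<^sup>+x. ennreal (- (h x * indicator (box a b) x)) \<partial>lborel)" for a b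
    by (auto simp: emeasure_density indicator_def intro!: nn_integral_cong)
  have hb: "integrable lborel (\<lambda>x. h x * indicator (box a b) x)" for a b
    using h by (intro integrable_real_mult_indicator) auto
  have box: "emeasure ?P (box a b) = emeasure ?N (box a b)" for a b
  proof -
    have "enn2real (emeasure ?P (box a b)) = enn2real (emeasure ?N (box a b))"
      using real_lebesgue_integral_def[OF hb[of a b]] zero[of a b] unfolding eP eN by simp
    moreover have "emeasure ?P (box a b) < top" "emeasure ?N (box a b) < top"
      using hb[of a b] unfolding eP eN real_integrable_def by (auto simp: less_top)
    ultimately show ?thesis using ennreal_enn2real by fastforce
  qed
  have "?P = ?N"
  proof (rule measure_eqI_generator_eq)
    let ?E = "range (\<lambda>(a, b). box a b::'a set)"
    show "Int_stable ?E"
      by (auto simp: Int_stable_def box_Int_box)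
    show "?E \<subseteq> Pow UNIV" "sets ?P = sigma_sets UNIV ?E" "sets ?N = sigma_sets UNIV ?E"
      by (simp_all add: borel_eq_box)
    let ?A = "\<lambda>n::nat. box (- (real n *\<^sub>R One)) (real n *\<^sub>R One) :: 'a set"
    show "range ?A \<subseteq> ?E" "(\<Union>i. ?A i) = UNIV"
      unfolding UN_box_eq_UNIV by auto
    show "emeasure ?P (?A i) \<noteq> \<infinity>" for i
      using hb unfolding eP real_integrable_def by auto
    show "emeasure ?P X = emeasure ?N X" if "X \<in> ?E" for X
      using that box by auto
  qed
  then have "AE x in lborel. ennreal (h x) = ennreal (- h x)"
    by (subst (asm) finite_density_unique) (use fin in auto)
  then show ?thesis
  proof eventually_elim
    case (elim x)
    show ?case
    proof (cases "h x \<ge> 0")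
      case True
      then have "ennreal (- h x) = 0" by (simp add: ennreal_neg)
      then show ?thesis using elim True by simp
    next
      case False
      then have "ennreal (h x) = 0" by (simp add: ennreal_neg)
      then show ?thesis using elim False by simp
    qed
  qed
qed

text \<open>A Lebesgue measurable h agrees almost everywhere with a Borel function, to which the
  Borel version applies.\<close>

lemma AE_zero_if_box_integrals_zero:
  fixes h :: "'a::euclidean_space \<Rightarrow> real"
  assumes h: "integrable lebesgue h"
    and zero: "\<And>a b. (\<integral>x. h x * indicator (box a b) x \<partial>lebesgue) = 0"
  shows "AE x in lebesgue. h x = 0"
proof -
  have hm: "h \<in> borel_measurable lebesgue" using h by auto
  then obtain h' where h': "h' \<in> borel_measurable lborel" and ae: "AE x in lborel. h x = h' x"
    by (auto dest: completion_ex_borel_measurable_real)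
  have h'm: "h' \<in> borel_measurable lebesgue" using h' by (auto intro: measurable_completion)
  have ae': "AE x in lebesgue. h x = h' x" using ae by (rule AE_completion)
  have "integrable lebesgue h'"
    using h integrable_cong_AE[OF hm h'm ae'] by simp
  then have "integrable lborel h'" using h' by (simp add: integrable_completion)
  moreover have "(\<integral>x. h' x * indicator (box a b) x \<partial>lborel) = 0" for a b
  proof -
    have "(\<integral>x. h' x * indicator (box a b) x \<partial>lborel) = (\<integral>x. h' x * indicator (box a b) x \<partial>lebesgue)"
      using h' by (subst integral_completion) auto
    also have "\<dots> = (\<integral>x. h x * indicator (box a b) x \<partial>lebesgue)"
      using ae' h'm hm by (intro integral_cong_AE borel_measurable_times borel_measurable_indicator) (auto elim: eventually_mono)
    finally show ?thesis using zero by simp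
  qed
  ultimately have "AE x in lborel. h' x = 0" by (rule AE_zero_if_box_integrals_zero_lborel)
  then have "AE x in lborel. h x = 0" using ae by eventually_elim simp
  then show ?thesis by (rule AE_completion)
qed

lemma continuous_imp_measurable_lebesgue_on:
  "continuous_on UNIV u \<Longrightarrow> u \<in> borel_measurable (lebesgue_on \<Omega>)"
  by (intro measurable_restrict_space1 measurable_completion) (simp add: borel_measurable_continuous_onI)

text \<open>Bumps converging to the indicator of a box show that g integrates to zero over every box
  whose closure lies in \<Omega>. Inside one such box this covers the intersection with any other
  box, so g vanishes there almost everywhere; countably many such boxes exhaust \<Omega>.\<close>

theorem fundamental_lemma_calculus_of_variations:
  fixes g :: "real^'n \<Rightarrow> real"
  assumes "open \<Omega>" and g: "integrable (lebesgue_on \<Omega>) g"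
    and zero: "\<And>\<phi>. test_fun \<Omega> \<phi> \<Longrightarrow> (\<integral>x. g x * \<phi> x \<partial>lebesgue_on \<Omega>) = 0"
  shows "AE x in lebesgue_on \<Omega>. g x = 0"
proof -
  have \<Omega>: "\<Omega> \<in> sets lebesgue" using assms(1) by auto
  have gi: "integrable lebesgue (\<lambda>x. indicator \<Omega> x *\<^sub>R g x)"
    using g \<Omega> by (simp add: integrable_restrict_space)
  have boxzero: "(\<integral>x. g x * indicator (box a b) x \<partial>lebesgue_on \<Omega>) = 0" if ab: "cbox a b \<subseteq> \<Omega>" for a b
  proof -
    have "(\<lambda>k. \<integral>x. g x * box_bump a b (real (Suc k)) x \<partial>lebesgue_on \<Omega>)
        \<longlonglongrightarrow> (\<integral>x. g x * indicator (box a b) x \<partial>lebesgue_on \<Omega>)"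
    proof (rule integral_dominated_convergence[where w="\<lambda>x. norm (g x)"])
      show "(\<lambda>x. g x * indicator (box a b) x) \<in> borel_measurable (lebesgue_on \<Omega>)"
        using g by (intro borel_measurable_times measurable_restrict_space1[OF borel_measurable_indicator]) auto
      show "(\<lambda>x. g x * box_bump a b (real (Suc k)) x) \<in> borel_measurable (lebesgue_on \<Omega>)" for k
        by (intro borel_measurable_times borel_measurable_integrable[OF g]
            continuous_imp_measurable_lebesgue_on[OF test_fun_continuous[OF test_fun_box_bump[OF ab]]]) auto
      show "AE x in lebesgue_on \<Omega>. (\<lambda>k. g x * box_bump a b (real (Suc k)) x) \<longlonglongrightarrow> g x * indicator (box a b) x"
        by (intro AE_I2 tendsto_mult_left box_bump_tendsto)
      show "AE x in lebesgue_on \<Omega>. norm (g x * box_bump a b (real (Suc k)) x) \<le> norm (g x)" for k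
        by (intro AE_I2) (simp add: abs_mult box_bump_bounds mult_left_le del: of_nat_Suc)
    qed (use g in auto)
    then have "(\<lambda>k. 0) \<longlonglongrightarrow> (\<integral>x. g x * indicator (box a b) x \<partial>lebesgue_on \<Omega>)"
      using zero[OF test_fun_box_bump[OF ab]] by simp
    then show ?thesis by (simp add: LIMSEQ_const_iff)
  qed
  have onbox: "AE x in lebesgue. x \<in> cbox a b \<longrightarrow> g x = 0" if ab: "cbox a b \<subseteq> \<Omega>" for a b
  proof -
    have sub: "box a b \<subseteq> \<Omega>" using ab box_subset_cbox by blast
    have "AE x in lebesgue. indicator (box a b) x * (indicator \<Omega> x *\<^sub>R g x) = 0"
    proof (rule AE_zero_if_box_integrals_zero)
      show "integrable lebesgue (\<lambda>x. indicator (box a b) x * (indicator \<Omega> x *\<^sub>R g x))"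
        using integrable_real_mult_indicator[OF _ gi, of "box a b"] by (simp add: mult.commute)
      fix c d
      let ?l = "(\<chi> i. max (a $ i) (c $ i))" and ?u = "(\<chi> i. min (b $ i) (d $ i))"
      have int: "box a b \<inter> box c d = box ?l ?u" by (auto simp: mem_box_cart)
      have "cbox ?l ?u \<subseteq> cbox a b" by (auto simp: mem_box_cart)
      then have "cbox ?l ?u \<subseteq> \<Omega>" using ab by (rule order_trans)
      then have "(\<integral>x. indicator \<Omega> x *\<^sub>R (g x * indicator (box ?l ?u) x) \<partial>lebesgue) = 0"
        using boxzero \<Omega> by (subst integral_restrict_space[symmetric]) auto
      then show "(\<integral>x. indicator (box a b) x * (indicator \<Omega> x *\<^sub>R g x) * indicator (box c d) x \<partial>lebesgue) = 0"
        unfolding int[symmetric] by (simp add: indicator_inter_arith mult_ac)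
    qed
    \<comment> \<open>The bumps see only open boxes, whereas \<Omega> is covered by closed ones; the
      faces form a null set.\<close>
    moreover have "AE x in lebesgue. x \<notin> cbox a b - box a b"
      using negligible_frontier_interval[of a b] by (intro AE_not_in) (simp add: negligible_iff_null_sets)
    ultimately show ?thesis
      by eventually_elim (use sub in \<open>auto simp: indicator_def split: if_splits\<close>)
  qed
  obtain \<D> where D: "countable \<D>" "\<D> \<subseteq> Pow \<Omega>" "\<And>X. X \<in> \<D> \<Longrightarrow> \<exists>a b. X = cbox a b" "\<Union>\<D> = \<Omega>"
    using open_countable_Union_open_cbox[OF assms(1)] by metis
  have "AE x in lebesgue. x \<in> X \<longrightarrow> g x = 0" if "X \<in> \<D>" for X
    using D(2,3) that onbox by blast
  then have "AE x in lebesgue. \<forall>X\<in>\<D>. x \<in> X \<longrightarrow> g x = 0"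
    using D(1) by (subst AE_ball_countable) auto
  then have "AE x in lebesgue. x \<in> \<Omega> \<longrightarrow> g x = 0"
    by eventually_elim (use D(4) in blast)
  then show ?thesis using \<Omega> by (simp add: AE_restrict_space_iff)
qed

section \<open>Uniqueness and linearity of weak gradients\<close>

lemma integrable_times_bounded_continuous:
  fixes g \<phi> :: "'a::euclidean_space \<Rightarrow> real"
  assumes "integrable (lebesgue_on \<Omega>) g" "continuous_on UNIV \<phi>" "\<And>x. \<bar>\<phi> x\<bar> \<le> C"
  shows "integrable (lebesgue_on \<Omega>) (\<lambda>x. g x * \<phi> x)"
proof (rule Bochner_Integration.integrable_bound)
  show "integrable (lebesgue_on \<Omega>) (\<lambda>x. C * g x)" using assms(1) by simp
  show "(\<lambda>x. g x * \<phi> x) \<in> borel_measurable (lebesgue_on \<Omega>)"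
    by (intro borel_measurable_times borel_measurable_integrable[OF assms(1)]
        continuous_imp_measurable_lebesgue_on[OF assms(2)])
  show "AE x in lebesgue_on \<Omega>. norm (g x * \<phi> x) \<le> norm (C * g x)"
  proof (rule AE_I2)
    fix x
    have "\<bar>\<phi> x\<bar> \<le> \<bar>C\<bar>" using assms(3)[of x] by linarith
    then show "norm (g x * \<phi> x) \<le> norm (C * g x)" by (simp add: abs_mult mult.commute[of "\<bar>g x\<bar>"] mult_right_mono)
  qed
qed

lemma integrable_vec_nth:
  fixes w :: "'a \<Rightarrow> ('b::euclidean_space)^'m"
  shows "integrable M w \<Longrightarrow> integrable M (\<lambda>x. w x $ i)"
  by (rule integrable_bounded_linear[OF bounded_linear_vec_nth])

text \<open>Each entry of G - H annihilates all test functions. This makes results about the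
  arbitrarily chosen \<open>weak_grad\<close> independent of the choice, up to null sets.\<close>

lemma is_weak_grad_unique:
  assumes "open \<Omega>" "is_weak_grad \<Omega> w G" "is_weak_grad \<Omega> w H"
  shows "AE x in lebesgue_on \<Omega>. G x = H x"
proof -
  have iG: "integrable (lebesgue_on \<Omega>) (\<lambda>x. G x $ i $ j)" and iH: "integrable (lebesgue_on \<Omega>) (\<lambda>x. H x $ i $ j)" for i j
    using assms(2,3) by (auto simp: is_weak_grad_def intro!: integrable_vec_nth)
  have "AE x in lebesgue_on \<Omega>. G x $ i $ j - H x $ i $ j = 0" for i j
  proof (rule fundamental_lemma_calculus_of_variations[OF assms(1)])
    show "integrable (lebesgue_on \<Omega>) (\<lambda>x. G x $ i $ j - H x $ i $ j)" using iG iH by simp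
    fix \<phi> assume \<phi>: "test_fun \<Omega> \<phi>"
    obtain C where C: "\<And>x. \<bar>\<phi> x\<bar> \<le> C" using test_fun_bounded[OF \<phi>] by blast
    note int = integrable_times_bounded_continuous[OF _ test_fun_continuous[OF \<phi>] C]
    have "- (\<integral>x. G x $ i $ j * \<phi> x \<partial>lebesgue_on \<Omega>) = - (\<integral>x. H x $ i $ j * \<phi> x \<partial>lebesgue_on \<Omega>)"
    proof -
      have "(\<integral>x. w x $ i * pderiv j \<phi> x \<partial>lebesgue_on \<Omega>) = - (\<integral>x. K x $ i $ j * \<phi> x \<partial>lebesgue_on \<Omega>)"
        if "is_weak_grad \<Omega> w K" for K
        using that \<phi> unfolding is_weak_grad_def by blast
      from this[OF assms(2)] this[OF assms(3)] show ?thesis by simp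
    qed
    then show "(\<integral>x. (G x $ i $ j - H x $ i $ j) * \<phi> x \<partial>lebesgue_on \<Omega>) = 0"
      using int[OF iG] int[OF iH] by (simp add: left_diff_distrib)
  qed
  then have "AE x in lebesgue_on \<Omega>. \<forall>i j. G x $ i $ j - H x $ i $ j = 0"
    by (simp add: eventually_all_finite)
  then show ?thesis by eventually_elim (simp add: vec_eq_iff)
qed

lemma is_weak_grad_linear:
  assumes "integrable (lebesgue_on \<Omega>) v" "integrable (lebesgue_on \<Omega>) w"
    and G: "is_weak_grad \<Omega> v G" and H: "is_weak_grad \<Omega> w H"
  shows "is_weak_grad \<Omega> (\<lambda>x. a *\<^sub>R v x + b *\<^sub>R w x) (\<lambda>x. a *\<^sub>R G x + b *\<^sub>R H x)"
  unfolding is_weak_grad_def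
proof (intro conjI allI impI)
  show "integrable (lebesgue_on \<Omega>) (\<lambda>x. a *\<^sub>R G x + b *\<^sub>R H x)"
    using G H by (simp add: is_weak_grad_def)
  fix \<phi> i j assume \<phi>: "test_fun \<Omega> \<phi>"
  obtain C where C: "\<And>x. \<bar>\<phi> x\<bar> \<le> C" using test_fun_bounded[OF \<phi>] by blast
  obtain C' where C': "\<And>x. \<bar>pderiv j \<phi> x\<bar> \<le> C'" using test_fun_pderiv_bounded[OF \<phi>] by blast
  note int = integrable_times_bounded_continuous[OF _ test_fun_continuous[OF \<phi>] C]
  note int' = integrable_times_bounded_continuous[OF _ test_fun_pderiv_continuous[OF \<phi>] C']
  have iG: "integrable (lebesgue_on \<Omega>) (\<lambda>x. G x $ i $ j)" and iH: "integrable (lebesgue_on \<Omega>) (\<lambda>x. H x $ i $ j)"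
    using G H by (auto simp: is_weak_grad_def intro!: integrable_vec_nth)
  have eG: "(\<integral>x. v x $ i * pderiv j \<phi> x \<partial>lebesgue_on \<Omega>) = - (\<integral>x. G x $ i $ j * \<phi> x \<partial>lebesgue_on \<Omega>)"
    using G \<phi> unfolding is_weak_grad_def by blast
  have eH: "(\<integral>x. w x $ i * pderiv j \<phi> x \<partial>lebesgue_on \<Omega>) = - (\<integral>x. H x $ i $ j * \<phi> x \<partial>lebesgue_on \<Omega>)"
    using H \<phi> unfolding is_weak_grad_def by blast
  show "(\<integral>x. (a *\<^sub>R v x + b *\<^sub>R w x) $ i * pderiv j \<phi> x \<partial>lebesgue_on \<Omega>)
      = - (\<integral>x. (a *\<^sub>R G x + b *\<^sub>R H x) $ i $ j * \<phi> x \<partial>lebesgue_on \<Omega>)"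
    using int[OF iG] int[OF iH] int'[OF integrable_vec_nth[OF assms(1)]] int'[OF integrable_vec_nth[OF assms(2)]] eG eH
    by (simp add: distrib_right mult.assoc)
qed

lemma W11_weak_grad: "w \<in> W11 \<Omega> \<Longrightarrow> is_weak_grad \<Omega> w (weak_grad \<Omega> w)"
  using someI_ex[of "is_weak_grad \<Omega> w"] by (simp add: W11_def weak_grad_def)

lemma weak_grad_linear:
  assumes "open \<Omega>" "v \<in> W11 \<Omega>" "w \<in> W11 \<Omega>"
  shows "(\<lambda>x. a *\<^sub>R v x + b *\<^sub>R w x) \<in> W11 \<Omega>"
    and "AE x in lebesgue_on \<Omega>. weak_grad \<Omega> (\<lambda>x. a *\<^sub>R v x + b *\<^sub>R w x) x
      = a *\<^sub>R weak_grad \<Omega> v x + b *\<^sub>R weak_grad \<Omega> w x"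
proof -
  have i: "integrable (lebesgue_on \<Omega>) v" "integrable (lebesgue_on \<Omega>) w"
    using assms by (auto simp: W11_def)
  note lin = is_weak_grad_linear[OF i W11_weak_grad[OF assms(2)] W11_weak_grad[OF assms(3)], of a b]
  then show *: "(\<lambda>x. a *\<^sub>R v x + b *\<^sub>R w x) \<in> W11 \<Omega>" using i by (auto simp: W11_def)
  show "AE x in lebesgue_on \<Omega>. weak_grad \<Omega> (\<lambda>x. a *\<^sub>R v x + b *\<^sub>R w x) x
      = a *\<^sub>R weak_grad \<Omega> v x + b *\<^sub>R weak_grad \<Omega> w x"
    by (rule is_weak_grad_unique[OF assms(1) W11_weak_grad[OF *] lin])
qed

subsection \<open>Integrals of the convex conjugate\<close>

lemma conj_fun_Young: "ereal (P \<bullet> Q - F P) \<le> conj_fun F Q"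
  unfolding conj_fun_def by (rule SUP_upper) simp

lemma conj_fun_nonneg: "F 0 = 0 \<Longrightarrow> 0 \<le> conj_fun F Q"
  using conj_fun_Young[of 0 Q F] by (simp add: zero_ereal_def)

text \<open>By continuity of F the matrices P with P : Q - F(P) > c form an open set, which a
  countable dense set meets whenever it is nonempty. The sequence is the same for all Q, which
  yields measurability and allows a pointwise search for near-maximizers.\<close>

lemma conj_fun_countable_SUP:
  fixes F :: "'a::euclidean_space \<Rightarrow> real"
  assumes "continuous_on UNIV F"
  obtains P :: "nat \<Rightarrow> 'a" where "\<And>Q. conj_fun F Q = (SUP k. ereal (P k \<bullet> Q - F (P k)))"
proof -
  obtain D :: "'a set" where D: "countable D" "\<And>X. open X \<Longrightarrow> X \<noteq> {} \<Longrightarrow> \<exists>d\<in>D. d \<in> X"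
    using countable_dense_setE by blast
  have "D \<noteq> {}" using D(2)[of UNIV] by auto
  then have range: "range (from_nat_into D) = D" using D(1) by (rule range_from_nat_into)
  show thesis
  proof (rule that[of "from_nat_into D"])
    fix Q
    show "conj_fun F Q = (SUP k. ereal (from_nat_into D k \<bullet> Q - F (from_nat_into D k)))" (is "_ = ?S")
    proof (rule antisym)
      show "?S \<le> conj_fun F Q" by (rule SUP_least) (rule conj_fun_Young)
      show "conj_fun F Q \<le> ?S"
        unfolding conj_fun_def
      proof (rule SUP_least, rule ccontr)
        fix P assume "\<not> ereal (P \<bullet> Q - F P) \<le> ?S"
        then obtain c where c: "?S < ereal c" "c < P \<bullet> Q - F P"
          using ereal_dense2[of ?S "ereal (P \<bullet> Q - F P)"] by (auto simp: not_le)
        have "open {R. c < R \<bullet> Q - F R}"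
          using assms by (intro open_Collect_less continuous_intros)
        moreover have "P \<in> {R. c < R \<bullet> Q - F R}" using c(2) by simp
        ultimately obtain d where "d \<in> D" "c < d \<bullet> Q - F d" using D(2) by blast
        moreover obtain k where "d = from_nat_into D k" using range \<open>d \<in> D\<close> by auto
        ultimately have "ereal c \<le> ?S"
          by (intro SUP_upper2[of k]) auto
        with c(1) show False by simp
      qed
    qed
  qed
qed

lemma borel_measurable_conj_fun:
  fixes F :: "'a::euclidean_space \<Rightarrow> real"
  assumes "continuous_on UNIV F"
  shows "conj_fun F \<in> borel_measurable borel"
proof -
  obtain P :: "nat \<Rightarrow> 'a" where "\<And>Q. conj_fun F Q = (SUP k. ereal (P k \<bullet> Q - F (P k)))"
    using conj_fun_countable_SUP[OF assms] by blast
  then have "conj_fun F = (\<lambda>Q. SUP k. ereal (P k \<bullet> Q - F (P k)))" by auto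
  then show ?thesis by simp
qed

text \<open>This exchanges supremum and integral. At each point the best of 0 and the first n
  members of a dense sequence is selected; the selections are measurable with finitely many values,
  so the hypothesis applies to them, and the attained values increase to the conjugate.\<close>

lemma nn_integral_conj_fun_le:
  fixes F :: "'b::euclidean_space \<Rightarrow> real" and \<sigma> :: "'a \<Rightarrow> 'b"
  assumes "finite_measure M" and \<sigma>: "\<sigma> \<in> borel_measurable M" and b\<sigma>: "\<And>x. norm (\<sigma> x) \<le> K"
    and F: "continuous_on UNIV F" "F 0 = 0"
    and le: "\<And>q. integrable M q \<Longrightarrow> integrable M (\<lambda>x. F (q x)) \<Longrightarrow> (\<integral>x. \<sigma> x \<bullet> q x - F (q x) \<partial>M) \<le> C"
  shows "(\<integral>\<^sup>+x. e2ennreal (conj_fun F (\<sigma> x)) \<partial>M) \<le> ennreal C"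
proof -
  interpret finite_measure M by fact
  have Fm [measurable]: "F \<in> borel_measurable borel" using F(1) by (rule borel_measurable_continuous_onI)
  obtain P :: "nat \<Rightarrow> 'b" where P: "\<And>Q. conj_fun F Q = (SUP k. ereal (P k \<bullet> Q - F (P k)))"
    using conj_fun_countable_SUP[OF F(1)] by blast
  define val where "val x p = \<sigma> x \<bullet> p - F p" for x p
  \<comment> \<open>The running maximizer starts at 0, where the value is 0 because F(0) = 0; all
    later values are therefore nonnegative, as monotone convergence in \<open>ennreal\<close>
    requires.\<close>
  define q where "q = rec_nat (\<lambda>x. 0) (\<lambda>n g x. if val x (g x) < val x (P n) then P n else g x)"
  have q0: "q 0 = (\<lambda>x. 0)" and qS: "q (Suc n) = (\<lambda>x. if val x (q n x) < val x (P n) then P n else q n x)" for n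
    unfolding q_def by simp_all
  have qm: "q n \<in> borel_measurable M" for n
  proof (induction n)
    case (Suc n)
    note [measurable] = Suc \<sigma>
    show ?case unfolding qS val_def by measurable
  qed (simp add: q0)
  note [measurable] = qm \<sigma>
  have qfin: "\<exists>S. finite S \<and> (\<forall>x. q n x \<in> S)" for n
  proof (induction n)
    case 0
    show ?case by (rule exI[of _ "{0}"]) (simp add: q0)
  next
    case (Suc n)
    then obtain S where "finite S" "\<forall>x. q n x \<in> S" by blast
    then show ?case by (intro exI[of _ "insert (P n) S"]) (simp add: qS)
  qed
  define m where "m n x = val x (q n x)" for n x
  have mono: "m n x \<le> m (Suc n) x" for n x by (simp add: m_def qS)
  have inc: "incseq (\<lambda>n. m n x)" for x by (rule incseq_SucI) (rule mono)
  have m0: "0 \<le> m n x" for n x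
    using incseqD[OF inc, of 0 n] by (simp add: m_def val_def q0 F(2))
  \<comment> \<open>\<open>P k\<close> enters the comparison only in the step from k to k + 1,
    whence the index \<open>Suc k\<close>.\<close>
  have mP: "P k \<bullet> \<sigma> x - F (P k) \<le> m (Suc k) x" for k x
    by (simp add: m_def qS val_def inner_commute)
  have msup: "conj_fun F (\<sigma> x) = (SUP n. ereal (m n x))" for x
  proof (rule antisym)
    show "conj_fun F (\<sigma> x) \<le> (SUP n. ereal (m n x))"
      unfolding P by (rule SUP_mono) (use mP in \<open>auto intro!: exI\<close>)
    show "(SUP n. ereal (m n x)) \<le> conj_fun F (\<sigma> x)"
      by (rule SUP_least) (simp add: m_def val_def inner_commute[of "\<sigma> x"] conj_fun_Young)
  qed
  have lim: "(\<lambda>n. ennreal (m n x)) \<longlonglongrightarrow> e2ennreal (conj_fun F (\<sigma> x))" for x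
  proof -
    have "(\<lambda>n. ereal (m n x)) \<longlonglongrightarrow> (SUP n. ereal (m n x))"
      by (rule LIMSEQ_SUP) (use inc in \<open>auto simp: incseq_def\<close>)
    then have "(\<lambda>n. e2ennreal (ereal (m n x))) \<longlonglongrightarrow> e2ennreal (conj_fun F (\<sigma> x))"
      unfolding msup by (rule tendsto_e2ennrealI)
    then show ?thesis by simp
  qed
  have mle: "(\<integral>\<^sup>+x. ennreal (m n x) \<partial>M) \<le> ennreal C" for n
  proof -
    obtain S where S: "finite S" "\<And>x. q n x \<in> S" using qfin by blast
    obtain B where B: "\<And>p. p \<in> S \<Longrightarrow> norm p \<le> B"
      using finite_imp_bounded[OF S(1)] unfolding bounded_iff by blast
    obtain B' where B': "\<And>p. p \<in> S \<Longrightarrow> norm (F p) \<le> B'"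
      using finite_imp_bounded[OF finite_imageI[OF S(1), of F]] unfolding bounded_iff by blast
    have qi: "integrable M (q n)"
      using B S by (intro integrable_const_bound[where B=B]) auto
    have Fi: "integrable M (\<lambda>x. F (q n x))"
      using B' S by (intro integrable_const_bound[where B=B']) auto
    have "integrable M (\<lambda>x. \<sigma> x \<bullet> q n x)"
    proof (rule integrable_const_bound[where B="K * B"])
      show "AE x in M. norm (\<sigma> x \<bullet> q n x) \<le> K * B"
      proof (rule AE_I2)
        fix x
        have "norm (\<sigma> x \<bullet> q n x) \<le> norm (\<sigma> x) * norm (q n x)" by (simp add: Cauchy_Schwarz_ineq2)
        also have "\<dots> \<le> K * B"
          using b\<sigma>[of x] B[OF S(2)[of x]] norm_ge_zero[of "\<sigma> x"] by (intro mult_mono norm_ge_zero) linarith+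
        finally show "norm (\<sigma> x \<bullet> q n x) \<le> K * B" .
      qed
    qed simp
    then have "(\<integral>\<^sup>+x. ennreal (m n x) \<partial>M) = ennreal (\<integral>x. \<sigma> x \<bullet> q n x - F (q n x) \<partial>M)"
      using Fi m0 unfolding m_def val_def by (intro nn_integral_eq_integral) auto
    also have "\<dots> \<le> ennreal C" using le[OF qi Fi] by (rule ennreal_leI)
    finally show ?thesis .
  qed
  have "(\<lambda>n. \<integral>\<^sup>+x. ennreal (m n x) \<partial>M) \<longlonglongrightarrow> (\<integral>\<^sup>+x. e2ennreal (conj_fun F (\<sigma> x)) \<partial>M)"
  proof (rule nn_integral_LIMSEQ)
    show "incseq (\<lambda>n x. ennreal (m n x))"
      using mono by (intro incseq_SucI le_funI ennreal_leI)
    show "(\<lambda>x. ennreal (m n x)) \<in> borel_measurable M" for n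
      unfolding m_def val_def by measurable
  qed (rule lim)
  then show ?thesis by (rule LIMSEQ_le_const2) (use mle in auto)
qed

section \<open>Integrals of extended real functions\<close>

lemma ereal_integral_ereal:
  assumes "integrable M h"
  shows "ereal_integral M (\<lambda>x. ereal (h x)) = ereal (\<integral>x. h x \<partial>M)"
proof -
  have "(\<integral>\<^sup>+x. ennreal (h x) \<partial>M) \<noteq> top" "(\<integral>\<^sup>+x. ennreal (- h x) \<partial>M) \<noteq> top"
    using assms by (auto simp: real_integrable_def)
  then show ?thesis
    using real_lebesgue_integral_def[OF assms] unfolding ereal_integral_def
    by (cases "\<integral>\<^sup>+x. ennreal (h x) \<partial>M"; cases "\<integral>\<^sup>+x. ennreal (- h x) \<partial>M") (auto simp: enn2ereal_ennreal)
qed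

lemma ereal_integral_cong_AE:
  assumes "AE x in M. u x = v x"
  shows "ereal_integral M u = ereal_integral M v"
proof -
  have "(\<integral>\<^sup>+x. e2ennreal (u x) \<partial>M) = (\<integral>\<^sup>+x. e2ennreal (v x) \<partial>M)"
    using assms by (intro nn_integral_cong_AE) auto
  moreover have "(\<integral>\<^sup>+x. e2ennreal (- u x) \<partial>M) = (\<integral>\<^sup>+x. e2ennreal (- v x) \<partial>M)"
    using assms by (intro nn_integral_cong_AE) auto
  ultimately show ?thesis by (simp add: ereal_integral_def)
qed

lemma finite_nn_integral_e2ennreal:
  assumes b: "b \<in> borel_measurable M" "\<And>x. 0 \<le> b x" and fin: "(\<integral>\<^sup>+x. e2ennreal (b x) \<partial>M) \<noteq> \<infinity>"
  shows "AE x in M. b x = ereal (real_of_ereal (b x))"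
    and "integrable M (\<lambda>x. real_of_ereal (b x))"
    and "(\<integral>\<^sup>+x. e2ennreal (b x) \<partial>M) = ennreal (\<integral>x. real_of_ereal (b x) \<partial>M)"
proof -
  have m: "(\<lambda>x. e2ennreal (b x)) \<in> borel_measurable M"
    using b(1) by (rule measurable_compose[OF _ measurable_e2ennreal])
  have "AE x in M. e2ennreal (b x) \<noteq> \<infinity>" using nn_integral_PInf_AE[OF m fin] .
  then show ae: "AE x in M. b x = ereal (real_of_ereal (b x))"
  proof eventually_elim
    case (elim x)
    then show ?case using b(2)[of x] by (cases "b x") auto
  qed
  have eq: "(\<integral>\<^sup>+x. e2ennreal (b x) \<partial>M) = (\<integral>\<^sup>+x. ennreal (real_of_ereal (b x)) \<partial>M)"
    using ae by (intro nn_integral_cong_AE) (auto elim!: eventually_mono, metis e2ennreal_ereal)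
  have "(\<integral>\<^sup>+x. ennreal (real_of_ereal (b x)) \<partial>M) < \<infinity>" using fin eq by (simp add: less_top)
  then show i: "integrable M (\<lambda>x. real_of_ereal (b x))"
    using b by (intro integrableI_nonneg) (auto simp: real_of_ereal_pos)
  show "(\<integral>\<^sup>+x. e2ennreal (b x) \<partial>M) = ennreal (\<integral>x. real_of_ereal (b x) \<partial>M)"
    unfolding eq using b(2) by (intro nn_integral_eq_integral i) (auto simp: real_of_ereal_pos)
qed

text \<open>If b has infinite integral, then the positive part of a - b is still at most |a|, while
  b \<le> max(b - a, 0) + |a| makes the negative part infinite; so the value is -\<infinity> and no
  difference of infinities arises. Otherwise b is finite almost everywhere and the real integral
  applies.\<close>

lemma ereal_integral_diff:
  fixes a :: "'a \<Rightarrow> real" and b :: "'a \<Rightarrow> ereal"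
  assumes a: "integrable M a" and b: "b \<in> borel_measurable M" "\<And>x. 0 \<le> b x"
  shows "ereal_integral M (\<lambda>x. ereal (a x) - b x)
    = ereal (\<integral>x. a x \<partial>M) - enn2ereal (\<integral>\<^sup>+x. e2ennreal (b x) \<partial>M)"
proof (cases "(\<integral>\<^sup>+x. e2ennreal (b x) \<partial>M) = \<infinity>")
  case False
  note fin = finite_nn_integral_e2ennreal[OF b False]
  let ?r = "\<lambda>x. real_of_ereal (b x)"
  have "ereal_integral M (\<lambda>x. ereal (a x) - b x) = ereal_integral M (\<lambda>x. ereal (a x - ?r x))"
  proof (rule ereal_integral_cong_AE)
    show "AE x in M. ereal (a x) - b x = ereal (a x - ?r x)"
      using fin(1)
    proof eventually_elim
      case (elim x)
      have "ereal (a x) - b x = ereal (a x) - ereal (?r x)" using elim by (rule arg_cong)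
      then show ?case by simp
    qed
  qed
  also have "\<dots> = ereal ((\<integral>x. a x \<partial>M) - (\<integral>x. ?r x \<partial>M))"
    using a fin(2) by (simp add: ereal_integral_ereal)
  also have "\<dots> = ereal (\<integral>x. a x \<partial>M) - enn2ereal (\<integral>\<^sup>+x. e2ennreal (b x) \<partial>M)"
  proof -
    have "(\<integral>x. ?r x \<partial>M) \<ge> 0" using b(2) by (intro integral_nonneg_AE) (simp add: real_of_ereal_pos)
    then show ?thesis by (simp add: fin(3) enn2ereal_ennreal)
  qed
  finally show ?thesis .
next
  case True
  have m: "(\<lambda>x. e2ennreal (- (ereal (a x) - b x))) \<in> borel_measurable M"
    using borel_measurable_integrable[OF a] b(1)
    by (intro measurable_compose[OF _ measurable_e2ennreal]) measurable
  have af: "(\<integral>\<^sup>+x. ennreal \<bar>a x\<bar> \<partial>M) < \<infinity>" using a by (simp add: integrable_iff_bounded)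
  have "(\<integral>\<^sup>+x. e2ennreal (ereal (a x) - b x) \<partial>M) \<le> (\<integral>\<^sup>+x. ennreal \<bar>a x\<bar> \<partial>M)"
  proof (rule nn_integral_mono)
    fix x
    have "ereal (a x) - b x \<le> ereal \<bar>a x\<bar>" using b(2)[of x] by (cases "b x") auto
    then show "e2ennreal (ereal (a x) - b x) \<le> ennreal \<bar>a x\<bar>"
      using e2ennreal_mono by fastforce
  qed
  with af have pos: "(\<integral>\<^sup>+x. e2ennreal (ereal (a x) - b x) \<partial>M) < \<infinity>" by (rule le_less_trans[rotated])
  have "(\<integral>\<^sup>+x. e2ennreal (b x) \<partial>M)
      \<le> (\<integral>\<^sup>+x. e2ennreal (- (ereal (a x) - b x)) + ennreal \<bar>a x\<bar> \<partial>M)"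
  proof (rule nn_integral_mono)
    fix x
    show "e2ennreal (b x) \<le> e2ennreal (- (ereal (a x) - b x)) + ennreal \<bar>a x\<bar>"
    proof (cases "b x")
      case (real r)
      \<comment> \<open>Since \<open>ennreal\<close> sends negative numbers to 0, the pointwise
        inequality is written with \<open>max 0 (r - a x)\<close>, for which \<open>ennreal\<close>
        is additive.\<close>
      then have "ennreal r \<le> ennreal (max 0 (r - a x) + \<bar>a x\<bar>)" by (intro ennreal_leI) linarith
      also have "\<dots> = ennreal (max 0 (r - a x)) + ennreal \<bar>a x\<bar>" by (rule ennreal_plus) auto
      also have "ennreal (max 0 (r - a x)) = ennreal (r - a x)" by (simp add: max_def ennreal_neg)
      finally show ?thesis using real by simp
    qed (use b(2)[of x] in auto)
  qed
  also have "\<dots> = (\<integral>\<^sup>+x. e2ennreal (- (ereal (a x) - b x)) \<partial>M) + (\<integral>\<^sup>+x. ennreal \<bar>a x\<bar> \<partial>M)"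
    using a m by (intro nn_integral_add) auto
  finally have "(\<integral>\<^sup>+x. e2ennreal (- (ereal (a x) - b x)) \<partial>M) = \<infinity>"
    using True af by (auto simp: top_unique ennreal_add_eq_top)
  moreover obtain r where "(\<integral>\<^sup>+x. e2ennreal (ereal (a x) - b x) \<partial>M) = ennreal r" "r \<ge> 0"
    using pos by (cases "\<integral>\<^sup>+x. e2ennreal (ereal (a x) - b x) \<partial>M") auto
  ultimately show ?thesis
    using True by (simp add: ereal_integral_def enn2ereal_ennreal)
qed

lemma ereal_integral_le_nn_integral:
  assumes "integrable M h"
  shows "ereal (\<integral>x. h x \<partial>M) \<le> enn2ereal (\<integral>\<^sup>+x. ennreal (h x) \<partial>M)"
proof -
  have "(\<integral>\<^sup>+x. ennreal (h x) \<partial>M) \<noteq> top"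
    using assms by (auto simp: real_integrable_def)
  then show ?thesis
    using real_lebesgue_integral_def[OF assms]
    by (cases "\<integral>\<^sup>+x. ennreal (h x) \<partial>M") (auto simp: enn2ereal_ennreal)
qed

subsection \<open>Duality for the variational problem\<close>

text \<open>For positive arguments this is convexity of the power function. If one argument is 0, it
  reduces to r^z \<le> r for 0 < r \<le> 1.\<close>

lemma powr_weighted_mean_le:
  fixes a b :: real
  assumes "a \<ge> 0" "b \<ge> 0" "s > 0" "t > 0" "s + t = 1" "z \<ge> 1"
  shows "(s * a + t * b) powr z \<le> s * a powr z + t * b powr z"
proof -
  have small: "(r * c) powr z \<le> r * c powr z" if "0 < r" "r \<le> 1" "c \<ge> 0" for r c
  proof -
    have "r powr z \<le> r powr 1" using that assms(6) by (intro powr_mono') auto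
    then show ?thesis using that by (simp add: powr_mult mult_right_mono)
  qed
  consider "a = 0" | "b = 0" | "a > 0" "b > 0" using assms by linarith
  then show ?thesis
  proof cases
    case 3
    have "((1 - t) *\<^sub>R a + t *\<^sub>R b) powr z \<le> (1 - t) * a powr z + t * b powr z"
      by (rule convex_onD[OF powr_convex[OF assms(6)]]) (use 3 assms in auto)
    moreover have "1 - t = s" using assms(5) by simp
    ultimately show ?thesis by simp
  qed (use small[of s a] small[of t b] assms in auto)
qed

lemma norm_powr_weighted_mean_le:
  fixes u v :: "'a::real_normed_vector"
  assumes "s > 0" "t > 0" "s + t = 1" "z \<ge> 1"
  shows "norm (s *\<^sub>R u + t *\<^sub>R v) powr z \<le> s * norm u powr z + t * norm v powr z"
proof -
  have "norm (s *\<^sub>R u + t *\<^sub>R v) powr z \<le> (s * norm u + t * norm v) powr z"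
    using assms norm_triangle_ineq[of "s *\<^sub>R u" "t *\<^sub>R v"] by (intro powr_mono2) auto
  also have "\<dots> \<le> s * norm u powr z + t * norm v powr z"
    using assms by (intro powr_weighted_mean_le) auto
  finally show ?thesis .
qed

lemma Lp_weighted_mean:
  assumes "u \<in> Lp z A" "v \<in> Lp z A" "s > 0" "t > 0" "s + t = 1" "z \<ge> 1"
  shows "(\<lambda>x. s *\<^sub>R u x + t *\<^sub>R v x) \<in> Lp z A"
proof -
  have m [measurable]: "u \<in> borel_measurable (lebesgue_on A)" "v \<in> borel_measurable (lebesgue_on A)"
    using assms by (auto simp: Lp_def)
  have "integrable (lebesgue_on A) (\<lambda>x. norm (s *\<^sub>R u x + t *\<^sub>R v x) powr z)"
  proof (rule Bochner_Integration.integrable_bound)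
    show "integrable (lebesgue_on A) (\<lambda>x. s * norm (u x) powr z + t * norm (v x) powr z)"
      using assms by (simp add: Lp_def)
    show "AE x in lebesgue_on A. norm (norm (s *\<^sub>R u x + t *\<^sub>R v x) powr z)
        \<le> norm (s * norm (u x) powr z + t * norm (v x) powr z)"
    proof (rule AE_I2)
      fix x
      show "norm (norm (s *\<^sub>R u x + t *\<^sub>R v x) powr z)
        \<le> norm (s * norm (u x) powr z + t * norm (v x) powr z)"
        using norm_powr_weighted_mean_le[OF assms(3-6), of "u x" "v x"] assms by simp
    qed
  qed measurable
  then show ?thesis by (simp add: Lp_def)
qed

text \<open>The difference u - v is twice the midpoint of u and - v, so closure under weighted means
  suffices.\<close>

lemma Lp_diff:
  assumes "u \<in> Lp z A" "v \<in> Lp z A" "z \<ge> 1"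
  shows "(\<lambda>x. u x - v x) \<in> Lp z A"
proof -
  have "(\<lambda>x. - v x) \<in> Lp z A" using assms(2) by (simp add: Lp_def)
  from Lp_weighted_mean[OF assms(1) this, of "1/2" "1/2"] assms(3)
  have h: "(\<lambda>x. (1/2) *\<^sub>R u x + (1/2) *\<^sub>R - v x) \<in> Lp z A" by simp
  have "norm (u x - v x) powr z = 2 powr z * norm ((1/2) *\<^sub>R u x + (1/2) *\<^sub>R - v x) powr z" for x
  proof -
    have "u x - v x = 2 *\<^sub>R ((1/2) *\<^sub>R u x + (1/2) *\<^sub>R - v x)" by (simp add: scaleR_right_diff_distrib)
    then have "norm (u x - v x) = 2 * norm ((1/2) *\<^sub>R u x + (1/2) *\<^sub>R - v x)"
      by (metis norm_scaleR abs_numeral)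
    then show ?thesis by (simp add: powr_mult)
  qed
  then show ?thesis using h assms(1,2) by (auto simp: Lp_def)
qed

lemma fidelity_weighted_mean_le:
  assumes "u \<in> Lp \<zeta> (\<Omega> - D)" "v \<in> Lp \<zeta> (\<Omega> - D)" "f \<in> Lp \<zeta> (\<Omega> - D)"
    and st: "s > 0" "t > 0" "s + t = 1" and z: "\<zeta> \<ge> 1" and lam: "lam \<ge> 0"
  shows "fidelity \<Omega> D \<zeta> lam f (\<lambda>x. s *\<^sub>R u x + t *\<^sub>R v x)
    \<le> s * fidelity \<Omega> D \<zeta> lam f u + t * fidelity \<Omega> D \<zeta> lam f v"
proof -
  let ?M = "lebesgue_on (\<Omega> - D)"
  have iu: "integrable ?M (\<lambda>x. norm (u x - f x) powr \<zeta>)" and iv: "integrable ?M (\<lambda>x. norm (v x - f x) powr \<zeta>)"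
    using Lp_diff[OF assms(1,3) z] Lp_diff[OF assms(2,3) z] by (auto simp: Lp_def)
  have iw: "integrable ?M (\<lambda>x. norm ((s *\<^sub>R u x + t *\<^sub>R v x) - f x) powr \<zeta>)"
    using Lp_diff[OF Lp_weighted_mean[OF assms(1,2) st z] assms(3) z] by (auto simp: Lp_def)
  have "norm ((s *\<^sub>R u x + t *\<^sub>R v x) - f x) powr \<zeta> \<le> s * norm (u x - f x) powr \<zeta> + t * norm (v x - f x) powr \<zeta>" for x
  proof -
    \<comment> \<open>The datum f is split as s f + t f, so the weighted mean passes to the
      residuals.\<close>
    have "s *\<^sub>R (u x - f x) + t *\<^sub>R (v x - f x) = (s *\<^sub>R u x + t *\<^sub>R v x) - (s + t) *\<^sub>R f x"
      by (simp add: algebra_simps)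
    then have "(s *\<^sub>R u x + t *\<^sub>R v x) - f x = s *\<^sub>R (u x - f x) + t *\<^sub>R (v x - f x)"
      using st by simp
    then show ?thesis using norm_powr_weighted_mean_le[OF st z] by simp
  qed
  then have "(\<integral>x. norm ((s *\<^sub>R u x + t *\<^sub>R v x) - f x) powr \<zeta> \<partial>?M)
      \<le> (\<integral>x. s * norm (u x - f x) powr \<zeta> + t * norm (v x - f x) powr \<zeta> \<partial>?M)"
    using iu iv iw by (intro integral_mono) auto
  then have "(lam / \<zeta>) * (\<integral>x. norm ((s *\<^sub>R u x + t *\<^sub>R v x) - f x) powr \<zeta> \<partial>?M)
      \<le> (lam / \<zeta>) * (s * (\<integral>x. norm (u x - f x) powr \<zeta> \<partial>?M) + t * (\<integral>x. norm (v x - f x) powr \<zeta> \<partial>?M))"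
    using iu iv z lam by (intro mult_left_mono) auto
  then show ?thesis by (simp add: fidelity_def algebra_simps)
qed

lemma fidelity_nonneg: "\<zeta> \<ge> 0 \<Longrightarrow> lam \<ge> 0 \<Longrightarrow> 0 \<le> fidelity \<Omega> D \<zeta> lam f w"
  by (simp add: fidelity_def)

section \<open>Bounded dual variables and the Lagrangian\<close>

lemma integrable_Linf_inner:
  fixes \<kappa> :: "real^'n \<Rightarrow> 'b::euclidean_space"
  assumes "\<kappa> \<in> Linf \<Omega>" and G: "integrable (lebesgue_on \<Omega>) G"
  shows "integrable (lebesgue_on \<Omega>) (\<lambda>x. \<kappa> x \<bullet> G x)"
proof -
  obtain C where C: "AE x in lebesgue_on \<Omega>. norm (\<kappa> x) \<le> C" and m: "\<kappa> \<in> borel_measurable (lebesgue_on \<Omega>)"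
    using assms(1) by (auto simp: Linf_def)
  show ?thesis
  proof (rule Bochner_Integration.integrable_bound)
    show "integrable (lebesgue_on \<Omega>) (\<lambda>x. C * norm (G x))" using G by simp
    show "(\<lambda>x. \<kappa> x \<bullet> G x) \<in> borel_measurable (lebesgue_on \<Omega>)"
      using m G by (intro borel_measurable_inner) auto
    show "AE x in lebesgue_on \<Omega>. norm (\<kappa> x \<bullet> G x) \<le> norm (C * norm (G x))"
      using C
    proof eventually_elim
      case (elim x)
      have "norm (\<kappa> x \<bullet> G x) \<le> norm (\<kappa> x) * norm (G x)" by (simp add: Cauchy_Schwarz_ineq2)
      also have "\<dots> \<le> \<bar>C\<bar> * norm (G x)" using elim by (intro mult_right_mono) auto
      finally show ?case by (simp add: abs_mult)
    qed
  qed
qed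

lemma Linf_weighted_mean:
  assumes "u \<in> Linf A" "v \<in> Linf A"
  shows "(\<lambda>x. s *\<^sub>R u x + t *\<^sub>R v x) \<in> Linf A"
proof -
  obtain C C' where "AE x in lebesgue_on A. norm (u x) \<le> C" "AE x in lebesgue_on A. norm (v x) \<le> C'"
    using assms by (auto simp: Linf_def)
  then have "AE x in lebesgue_on A. norm (s *\<^sub>R u x + t *\<^sub>R v x) \<le> \<bar>s\<bar> * C + \<bar>t\<bar> * C'"
  proof eventually_elim
    case (elim x)
    have "norm (s *\<^sub>R u x + t *\<^sub>R v x) \<le> \<bar>s\<bar> * norm (u x) + \<bar>t\<bar> * norm (v x)"
      by (rule order_trans[OF norm_triangle_ineq]) simp
    also have "\<dots> \<le> \<bar>s\<bar> * C + \<bar>t\<bar> * C'" using elim by (intro add_mono mult_left_mono) auto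
    finally show ?case .
  qed
  then show ?thesis using assms by (auto simp: Linf_def)
qed

definition conj_integral :: "(real^'n^'m \<Rightarrow> real) \<Rightarrow> (real^'n) set \<Rightarrow> (real^'n \<Rightarrow> real^'n^'m) \<Rightarrow> ennreal" where
  "conj_integral F \<Omega> \<kappa> = (\<integral>\<^sup>+x. e2ennreal (conj_fun F (\<kappa> x)) \<partial>lebesgue_on \<Omega>)"

lemma integrable_weak_grad: "w \<in> W11 \<Omega> \<Longrightarrow> integrable (lebesgue_on \<Omega>) (weak_grad \<Omega> w)"
  using W11_weak_grad[of w \<Omega>] by (simp add: is_weak_grad_def)

lemma conj_fun_Linf_measurable:
  fixes \<kappa> :: "real^'n \<Rightarrow> 'b::euclidean_space"
  assumes "continuous_on UNIV F" "\<kappa> \<in> Linf \<Omega>"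
  shows "(\<lambda>x. conj_fun F (\<kappa> x)) \<in> borel_measurable (lebesgue_on \<Omega>)"
  using assms by (intro measurable_compose[OF _ borel_measurable_conj_fun]) (auto simp: Linf_def)

text \<open>The pairing of a bounded \<kappa> with an integrable gradient is finite and the
  conjugate is nonnegative, so the integral splits. The one term that may be infinite is independent
  of w.\<close>

lemma lfun_eq:
  fixes F :: "real^'n^'m \<Rightarrow> real"
  assumes F: "continuous_on UNIV F" "F 0 = 0" and \<kappa>: "\<kappa> \<in> Linf \<Omega>" and w: "w \<in> W11 \<Omega>"
  shows "lfun F \<Omega> D \<zeta> lam f w \<kappa>
    = ereal ((\<integral>x. \<kappa> x \<bullet> weak_grad \<Omega> w x \<partial>lebesgue_on \<Omega>) + fidelity \<Omega> D \<zeta> lam f w)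
      - enn2ereal (conj_integral F \<Omega> \<kappa>)"
proof -
  have "ereal_integral (lebesgue_on \<Omega>) (\<lambda>x. ereal (\<kappa> x \<bullet> weak_grad \<Omega> w x) - conj_fun F (\<kappa> x))
    = ereal (\<integral>x. \<kappa> x \<bullet> weak_grad \<Omega> w x \<partial>lebesgue_on \<Omega>) - enn2ereal (conj_integral F \<Omega> \<kappa>)"
    unfolding conj_integral_def
    by (intro ereal_integral_diff integrable_Linf_inner[OF \<kappa>] integrable_weak_grad[OF w]
        conj_fun_Linf_measurable[OF F(1) \<kappa>] conj_fun_nonneg[of F, OF F(2)])
  then show ?thesis
    unfolding lfun_def by (cases "conj_integral F \<Omega> \<kappa>") (auto simp: enn2ereal_ennreal)
qed

lemma integrable_Lipschitz_compose:
  fixes F :: "'b::euclidean_space \<Rightarrow> real"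
  assumes "continuous_on UNIV F" "F 0 = 0" and lip: "\<And>A B. \<bar>F A - F B\<bar> \<le> L * norm (A - B)"
    and G: "integrable M G"
  shows "integrable M (\<lambda>x. F (G x))"
proof (rule Bochner_Integration.integrable_bound)
  show "integrable M (\<lambda>x. L * norm (G x))" using G by simp
  show "(\<lambda>x. F (G x)) \<in> borel_measurable M"
    using G borel_measurable_continuous_onI[OF assms(1)] by (intro measurable_compose[of G M borel F borel]) auto
  show "AE x in M. norm (F (G x)) \<le> norm (L * norm (G x))"
  proof (rule AE_I2)
    fix x
    have "\<bar>F (G x)\<bar> \<le> L * norm (G x)" using lip[of "G x" 0] assms(2) by simp
    then show "norm (F (G x)) \<le> norm (L * norm (G x))" by simp
  qed
qed

text \<open>Young's inequality at P = \<nabla>w is integrated and the fidelity terms cancel. If the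
  integral of the conjugate is infinite, the left side is -\<infinity>.\<close>

lemma weak_duality:
  fixes F :: "real^'n^'m \<Rightarrow> real"
  assumes F: "continuous_on UNIV F" "F 0 = 0" and lip: "\<And>A B. \<bar>F A - F B\<bar> \<le> L * norm (A - B)"
    and \<kappa>: "\<kappa> \<in> Linf \<Omega>" and w: "w \<in> W11 \<Omega>"
  shows "lfun F \<Omega> D \<zeta> lam f w \<kappa> \<le> ereal (Ifun F \<Omega> D \<zeta> lam f w)"
proof -
  let ?M = "lebesgue_on \<Omega>"
  let ?G = "weak_grad \<Omega> w"
  note iG = integrable_weak_grad[OF w]
  have i: "integrable ?M (\<lambda>x. \<kappa> x \<bullet> ?G x)" by (rule integrable_Linf_inner[OF \<kappa> iG])
  have iF: "integrable ?M (\<lambda>x. F (?G x))" by (rule integrable_Lipschitz_compose[OF F lip iG])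
  have "ereal (\<integral>x. \<kappa> x \<bullet> ?G x - F (?G x) \<partial>?M) \<le> enn2ereal (\<integral>\<^sup>+x. ennreal (\<kappa> x \<bullet> ?G x - F (?G x)) \<partial>?M)"
    using i iF by (intro ereal_integral_le_nn_integral) auto
  also have "\<dots> \<le> enn2ereal (conj_integral F \<Omega> \<kappa>)"
    unfolding conj_integral_def less_eq_ennreal.rep_eq[symmetric]
  proof (rule nn_integral_mono)
    fix x
    show "ennreal (\<kappa> x \<bullet> ?G x - F (?G x)) \<le> e2ennreal (conj_fun F (\<kappa> x))"
      using e2ennreal_mono[OF conj_fun_Young[of "?G x" "\<kappa> x" F]] by (simp add: inner_commute)
  qed
  finally have "ereal ((\<integral>x. \<kappa> x \<bullet> ?G x \<partial>?M) - (\<integral>x. F (?G x) \<partial>?M)) \<le> enn2ereal (conj_integral F \<Omega> \<kappa>)"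
    using i iF by simp
  then show ?thesis
    unfolding lfun_eq[OF F \<kappa> w] Ifun_def
    by (cases "conj_integral F \<Omega> \<kappa>") (auto simp: enn2ereal_ennreal)
qed

lemma zero_in_W11_Lp: "(\<lambda>_. 0) \<in> W11 \<Omega> \<inter> Lp z A"
proof -
  have "is_weak_grad \<Omega> (\<lambda>_. 0 :: real^'b) (\<lambda>_. 0)" by (simp add: is_weak_grad_def)
  then show ?thesis by (auto simp: W11_def Lp_def)
qed

text \<open>Combined with \<open>weak_duality\<close>, this lower bound makes \<sigma> a maximizer
  and closes the duality gap.\<close>

theorem dual_solution_exists:
  fixes F :: "real^'n^'m \<Rightarrow> real" and \<Omega> D :: "(real^'n) set"
  assumes dom: "open \<Omega>" "bounded \<Omega>" and zeta: "\<zeta> \<ge> 1" and lam: "lam \<ge> 0"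
    and f: "f \<in> Lp \<zeta> (\<Omega> - D)"
    and Fnn: "\<And>P. F P \<ge> 0" and F0: "F 0 = 0" and Fconv: "convex_on UNIV F"
    and lip: "\<And>A B. \<bar>F A - F B\<bar> \<le> L * norm (A - B)"
  shows "\<exists>\<sigma>\<in>Linf \<Omega>. ereal (INF v \<in> W11 \<Omega> \<inter> Lp \<zeta> (\<Omega> - D). Ifun F \<Omega> D \<zeta> lam f v)
    \<le> Rfun F \<Omega> D \<zeta> lam f \<sigma>"
proof -
  let ?M = "lebesgue_on \<Omega>"
  let ?W = "W11 \<Omega> \<inter> Lp \<zeta> (\<Omega> - D) :: (real^'n \<Rightarrow> real^'m) set"
  let ?fid = "fidelity \<Omega> D \<zeta> lam f"
  have cF: "continuous_on UNIV F"
  proof (rule lipschitz_on_continuous_on)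
    show "\<bar>L\<bar>-lipschitz_on UNIV F"
    proof (rule lipschitz_onI)
      fix A B :: "real^'n^'m"
      have "\<bar>F A - F B\<bar> \<le> L * norm (A - B)" by (rule lip)
      also have "\<dots> \<le> \<bar>L\<bar> * norm (A - B)" by (intro mult_right_mono) auto
      finally show "dist (F A) (F B) \<le> \<bar>L\<bar> * dist A B" by (simp add: dist_norm)
    qed simp
  qed
  have L: "L \<ge> 0"
  proof -
    obtain b :: "real^'n^'m" where "b \<in> Basis" using nonempty_Basis by blast
    then have "norm b = 1" by simp
    then show ?thesis using lip[of b 0] by simp
  qed
  have fin: "finite_measure ?M"
  proof (rule finite_measureI)
    have "emeasure lebesgue \<Omega> < \<infinity>" using dom by (intro emeasure_bounded_finite[THEN order.strict_trans1[rotated]]) auto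
    then show "emeasure ?M (space ?M) \<noteq> \<infinity>" using dom by (simp add: emeasure_restrict_space)
  qed
  have W0: "(\<lambda>_. 0) \<in> ?W" by (rule zero_in_W11_Lp)
  define J where "J p w = (\<integral>x. F (weak_grad \<Omega> w x + p x) \<partial>?M) + ?fid w" for p w
  define h where "h p = (INF w\<in>?W. J p w)" for p
  have iF: "integrable ?M (\<lambda>x. F (G x))" if "integrable ?M G" for G
    by (rule integrable_Lipschitz_compose[OF cF F0 lip that])
  have iJ: "integrable ?M (\<lambda>x. F (weak_grad \<Omega> w x + p x))" if "w \<in> ?W" "integrable ?M p" for w p
    using that by (intro iF Bochner_Integration.integrable_add integrable_weak_grad) auto
  have J0: "0 \<le> J p w" for p w
    unfolding J_def using Fnn fidelity_nonneg[of \<zeta> lam] zeta lam by (intro add_nonneg_nonneg integral_nonneg_AE) auto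
  have bdd: "bdd_below (J p ` ?W)" for p by (rule bdd_belowI2) (rule J0)
  have Jlip: "J p w \<le> J q w + L * (\<integral>x. norm (p x - q x) \<partial>?M)"
    if "w \<in> ?W" "integrable ?M p" "integrable ?M q" for p q w
  proof -
    have "(\<integral>x. F (weak_grad \<Omega> w x + p x) \<partial>?M) \<le> (\<integral>x. F (weak_grad \<Omega> w x + q x) + L * norm (p x - q x) \<partial>?M)"
    proof (rule integral_mono)
      fix x
      show "F (weak_grad \<Omega> w x + p x) \<le> F (weak_grad \<Omega> w x + q x) + L * norm (p x - q x)"
        using lip[of "weak_grad \<Omega> w x + p x" "weak_grad \<Omega> w x + q x"] by (simp add: abs_le_iff)
    qed (use iJ that in auto)
    then show ?thesis using iJ that by (simp add: J_def)
  qed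
  \<comment> \<open>The Lipschitz estimate for J has a constant independent of w, so it survives the
    infimum.\<close>
  have hlip: "h p \<le> h q + L * (\<integral>x. norm (p x - q x) \<partial>?M)" if "integrable ?M p" "integrable ?M q" for p q
  proof -
    have "h p - L * (\<integral>x. norm (p x - q x) \<partial>?M) \<le> h q"
      unfolding h_def[of q]
    proof (rule cINF_greatest)
      show "?W \<noteq> {}" using W0 by blast
      fix w assume w: "w \<in> ?W"
      have "h p \<le> J p w" unfolding h_def by (rule cINF_lower[OF bdd w])
      then show "h p - L * (\<integral>x. norm (p x - q x) \<partial>?M) \<le> J q w" using Jlip[OF w that] by simp
    qed
    then show ?thesis by simp
  qed
  have hconv: "h (\<lambda>x. s *\<^sub>R p x + t *\<^sub>R q x) \<le> s * h p + t * h q"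
    if p: "integrable ?M p" and q: "integrable ?M q" and st: "0 < s" "0 < t" "s + t = 1" for p q s t
    unfolding h_def
  \<comment> \<open>The competitor for the mean of p and q is the same mean of near-optimal u and v:
    partial minimization of a jointly convex function is convex.\<close>
  proof (rule cINF_le_weighted_add[OF bdd _ _ st(1,2)])
    fix u v assume u: "u \<in> ?W" and v: "v \<in> ?W"
    let ?w = "\<lambda>x. s *\<^sub>R u x + t *\<^sub>R v x"
    have uv: "u \<in> W11 \<Omega>" "v \<in> W11 \<Omega>" "u \<in> Lp \<zeta> (\<Omega> - D)" "v \<in> Lp \<zeta> (\<Omega> - D)" using u v by auto
    note lin = weak_grad_linear[OF dom(1) uv(1,2), of s t]
    have w: "?w \<in> ?W" using lin(1) Lp_weighted_mean[OF uv(3,4) st zeta] by blast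
    have "(\<integral>x. F (weak_grad \<Omega> ?w x + (s *\<^sub>R p x + t *\<^sub>R q x)) \<partial>?M)
        \<le> (\<integral>x. s * F (weak_grad \<Omega> u x + p x) + t * F (weak_grad \<Omega> v x + q x) \<partial>?M)"
    proof (rule integral_mono_AE)
      show "integrable ?M (\<lambda>x. F (weak_grad \<Omega> ?w x + (s *\<^sub>R p x + t *\<^sub>R q x)))"
        using p q by (intro iJ w) auto
      show "integrable ?M (\<lambda>x. s * F (weak_grad \<Omega> u x + p x) + t * F (weak_grad \<Omega> v x + q x))"
        using iJ[OF u p] iJ[OF v q] by simp
      show "AE x in ?M. F (weak_grad \<Omega> ?w x + (s *\<^sub>R p x + t *\<^sub>R q x))
          \<le> s * F (weak_grad \<Omega> u x + p x) + t * F (weak_grad \<Omega> v x + q x)"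
        using lin(2)
      proof eventually_elim
        case (elim x)
        have s: "s = 1 - t" using st by simp
        have "weak_grad \<Omega> ?w x + (s *\<^sub>R p x + t *\<^sub>R q x)
            = (1 - t) *\<^sub>R (weak_grad \<Omega> u x + p x) + t *\<^sub>R (weak_grad \<Omega> v x + q x)"
          using elim unfolding s by (simp add: scaleR_add_right)
        then show ?case using convex_onD[OF Fconv, of t] st by (simp add: s)
      qed
    qed
    also have "\<dots> = s * (\<integral>x. F (weak_grad \<Omega> u x + p x) \<partial>?M) + t * (\<integral>x. F (weak_grad \<Omega> v x + q x) \<partial>?M)"
      using iJ[OF u p] iJ[OF v q] by simp
    finally have "J (\<lambda>x. s *\<^sub>R p x + t *\<^sub>R q x) ?w \<le> s * J p u + t * J q v"
      using fidelity_weighted_mean_le[OF uv(3,4) f st zeta lam] by (simp add: J_def algebra_simps)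
    then show "\<exists>w\<in>?W. J (\<lambda>x. s *\<^sub>R p x + t *\<^sub>R q x) w \<le> s * J p u + t * J q v" using w by blast
  qed (use W0 in blast)+
  have lip0: "\<bar>h p - h (\<lambda>_. 0)\<bar> \<le> L * (\<integral>x. norm (p x) \<partial>?M)" if "integrable ?M p" for p
    using hlip[OF that, of "\<lambda>_. 0"] hlip[OF _ that, of "\<lambda>_. 0"] by (simp add: abs_le_iff)
  obtain \<sigma> K where \<sigma>: "\<sigma> \<in> borel_measurable ?M" "\<And>x. norm (\<sigma> x) \<le> K"
    and sub: "\<And>p. integrable ?M p \<Longrightarrow> (\<integral>x. \<sigma> x \<bullet> p x \<partial>?M) \<le> h p - h (\<lambda>_. 0)"
    using L1_subgradient[OF fin L hconv lip0] by blast
  have \<sigma>L: "\<sigma> \<in> Linf \<Omega>" using \<sigma> unfolding Linf_def by auto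
  have "h (\<lambda>_. 0) = (INF v\<in>?W. Ifun F \<Omega> D \<zeta> lam f v)" by (simp add: h_def J_def Ifun_def)
  moreover have "ereal (h (\<lambda>_. 0)) \<le> Rfun F \<Omega> D \<zeta> lam f \<sigma>"
    unfolding Rfun_def
  proof (rule INF_greatest)
    fix w assume w: "w \<in> ?W"
    let ?G = "weak_grad \<Omega> w"
    \<comment> \<open>This is l w \<sigma> without its conjugate term, minus h 0; the goal is thus
      equivalent to the integral of the conjugate at \<sigma> being at most C.\<close>
    define C where "C = (\<integral>x. \<sigma> x \<bullet> ?G x \<partial>?M) + ?fid w - h (\<lambda>_. 0)"
    have iG: "integrable ?M ?G" using w by (intro integrable_weak_grad) auto
    have le: "(\<integral>x. \<sigma> x \<bullet> q x - F (q x) \<partial>?M) \<le> C" if q: "integrable ?M q" for q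
    proof -
      \<comment> \<open>With p = q - \<nabla>w the function w itself is a competitor for h p, and
        its perturbed gradient is exactly q.\<close>
      have "(\<integral>x. \<sigma> x \<bullet> (q x - ?G x) \<partial>?M) \<le> h (\<lambda>x. q x - ?G x) - h (\<lambda>_. 0)"
        using q iG by (intro sub) auto
      also have "h (\<lambda>x. q x - ?G x) \<le> J (\<lambda>x. q x - ?G x) w"
        unfolding h_def by (rule cINF_lower[OF bdd w])
      finally show ?thesis
        using integrable_Linf_inner[OF \<sigma>L q] integrable_Linf_inner[OF \<sigma>L iG] iF[OF q]
        by (simp add: C_def J_def inner_diff_right)
    qed
    \<comment> \<open>Nonnegativity is needed so that \<open>ennreal C\<close> does not truncate
      C.\<close>
    have C0: "C \<ge> 0" using le[of "\<lambda>_. 0"] by (simp add: F0)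
    have "conj_integral F \<Omega> \<sigma> \<le> ennreal C"
      unfolding conj_integral_def by (rule nn_integral_conj_fun_le[OF fin \<sigma> cF F0 le])
    then have "enn2ereal (conj_integral F \<Omega> \<sigma>) \<le> ereal C"
      using C0 by (simp add: less_eq_ennreal.rep_eq enn2ereal_ennreal)
    then show "ereal (h (\<lambda>_. 0)) \<le> lfun F \<Omega> D \<zeta> lam f w \<sigma>"
      unfolding lfun_eq[OF cF F0 \<sigma>L IntD1[OF w]]
      by (cases "conj_integral F \<Omega> \<sigma>") (auto simp: enn2ereal_ennreal C_def)
  qed
  ultimately show ?thesis using \<sigma>L by auto
qed

text \<open>A strict inequality for each w could be lost in the infimum over w. The convexity gap d
  of the conjugate at the midpoint does not involve w, so its integral is added to R as a whole;
  maximality then forces this integral to vanish.\<close>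

theorem dual_solution_unique:
  fixes F :: "real^'n^'m \<Rightarrow> real" and \<Omega> D :: "(real^'n) set"
  assumes F: "continuous_on UNIV F" "F 0 = 0"
    and sc: "strict_convex_on {p. conj_fun F p < \<infinity>} (\<lambda>p. real_of_ereal (conj_fun F p))"
    and \<sigma>1: "\<sigma>1 \<in> Linf \<Omega>" and \<sigma>2: "\<sigma>2 \<in> Linf \<Omega>"
    and max1: "\<And>\<tau>. \<tau> \<in> Linf \<Omega> \<Longrightarrow> Rfun F \<Omega> D \<zeta> lam f \<tau> \<le> ereal m"
    and m1: "ereal m \<le> Rfun F \<Omega> D \<zeta> lam f \<sigma>1" and m2: "ereal m \<le> Rfun F \<Omega> D \<zeta> lam f \<sigma>2"
    and W0: "W11 \<Omega> \<inter> Lp \<zeta> (\<Omega> - D) \<noteq> ({} :: (real^'n \<Rightarrow> real^'m) set)"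
  shows "AE x in lebesgue_on \<Omega>. \<sigma>1 x = \<sigma>2 x"
proof -
  let ?M = "lebesgue_on \<Omega>"
  let ?W = "W11 \<Omega> \<inter> Lp \<zeta> (\<Omega> - D) :: (real^'n \<Rightarrow> real^'m) set"
  let ?fid = "fidelity \<Omega> D \<zeta> lam f"
  define r where "r \<kappa> x = real_of_ereal (conj_fun F (\<kappa> x))" for \<kappa> :: "real^'n \<Rightarrow> real^'n^'m" and x
  define \<sigma> where "\<sigma> x = (1/2) *\<^sub>R \<sigma>1 x + (1/2) *\<^sub>R \<sigma>2 x" for x
  have \<sigma>: "\<sigma> \<in> Linf \<Omega>" unfolding \<sigma>_def by (rule Linf_weighted_mean[OF \<sigma>1 \<sigma>2])
  have fin: "conj_integral F \<Omega> \<kappa> \<noteq> \<infinity>" if "\<kappa> \<in> Linf \<Omega>" "ereal m \<le> Rfun F \<Omega> D \<zeta> lam f \<kappa>" for \<kappa>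
  proof
    assume inf: "conj_integral F \<Omega> \<kappa> = \<infinity>"
    \<comment> \<open>A single admissible w suffices: an infinite conjugate integral would give l
      the value -\<infinity>, below m.\<close>
    obtain w where w: "w \<in> ?W" using W0 by blast
    have "ereal m \<le> lfun F \<Omega> D \<zeta> lam f w \<kappa>"
      using that(2) INF_lower[OF w] unfolding Rfun_def by (rule order_trans)
    then show False using w inf by (simp add: lfun_eq[OF F that(1)])
  qed
  have conj: "AE x in ?M. conj_fun F (\<kappa> x) = ereal (r \<kappa> x)" "integrable ?M (r \<kappa>)"
    "conj_integral F \<Omega> \<kappa> = ennreal (\<integral>x. r \<kappa> x \<partial>?M)" if "\<kappa> \<in> Linf \<Omega>" "conj_integral F \<Omega> \<kappa> \<noteq> \<infinity>" for \<kappa>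
    using finite_nn_integral_e2ennreal[OF conj_fun_Linf_measurable[OF F(1) that(1)] conj_fun_nonneg[of F, OF F(2)]] that(2)
    unfolding conj_integral_def r_def by auto
  have r0: "0 \<le> r \<kappa> x" for \<kappa> x
    unfolding r_def by (rule real_of_ereal_pos) (rule conj_fun_nonneg[of F, OF F(2)])
  have lreal: "lfun F \<Omega> D \<zeta> lam f w \<kappa>
      = ereal ((\<integral>x. \<kappa> x \<bullet> weak_grad \<Omega> w x \<partial>?M) + ?fid w - (\<integral>x. r \<kappa> x \<partial>?M))"
    if "\<kappa> \<in> Linf \<Omega>" "conj_integral F \<Omega> \<kappa> \<noteq> \<infinity>" "w \<in> ?W" for \<kappa> w
    using that(3) conj(3)[OF that(1,2)] r0 by (simp add: lfun_eq[OF F that(1)] enn2ereal_ennreal integral_nonneg_AE)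
  note fin1 = fin[OF \<sigma>1 m1] and fin2 = fin[OF \<sigma>2 m2]
  note c1 = conj[OF \<sigma>1 fin1] and c2 = conj[OF \<sigma>2 fin2]
  have pt: "AE x in ?M. conj_fun F (\<sigma> x) < \<infinity> \<and> r \<sigma> x \<le> 1/2 * r \<sigma>1 x + 1/2 * r \<sigma>2 x
      \<and> (\<sigma>1 x \<noteq> \<sigma>2 x \<longrightarrow> r \<sigma> x < 1/2 * r \<sigma>1 x + 1/2 * r \<sigma>2 x)"
    using c1(1) c2(1)
  proof eventually_elim
    case (elim x)
    then have in12: "\<sigma>1 x \<in> {p. conj_fun F p < \<infinity>}" "\<sigma>2 x \<in> {p. conj_fun F p < \<infinity>}" by auto
    show ?case
    proof (cases "\<sigma>1 x = \<sigma>2 x")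
      case True
      then have "\<sigma> x = \<sigma>1 x" "\<sigma> x = \<sigma>2 x" by (simp_all add: \<sigma>_def flip: scaleR_add_left)
      then show ?thesis using in12 True by (simp add: r_def)
    next
      case False
      have "\<sigma> x \<in> {p. conj_fun F p < \<infinity>}"
        unfolding \<sigma>_def using sc in12 by (intro convexD) (auto simp: strict_convex_on_def)
      moreover have "r \<sigma> x < 1/2 * r \<sigma>1 x + 1/2 * r \<sigma>2 x"
      proof -
        have "\<forall>t. 0 < t \<and> t < 1 \<longrightarrow> real_of_ereal (conj_fun F ((1 - t) *\<^sub>R \<sigma>1 x + t *\<^sub>R \<sigma>2 x))
            < (1 - t) * r \<sigma>1 x + t * r \<sigma>2 x"
          using sc in12 False unfolding strict_convex_on_def r_def by blast
        from this[rule_format, of "1/2"] show ?thesis by (simp add: r_def \<sigma>_def)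
      qed
      ultimately show ?thesis by simp
    qed
  qed
  \<comment> \<open>Finiteness at the midpoint is obtained first, so that l at \<sigma> can be
    handled with real integrals.\<close>
  have "conj_integral F \<Omega> \<sigma> \<le> (\<integral>\<^sup>+x. ennreal (1/2 * r \<sigma>1 x + 1/2 * r \<sigma>2 x) \<partial>?M)"
    unfolding conj_integral_def
  proof (rule nn_integral_mono_AE)
    show "AE x in ?M. e2ennreal (conj_fun F (\<sigma> x)) \<le> ennreal (1/2 * r \<sigma>1 x + 1/2 * r \<sigma>2 x)"
      using pt
    proof eventually_elim
      case (elim x)
      then have "conj_fun F (\<sigma> x) = ereal (r \<sigma> x)"
        using conj_fun_nonneg[of F "\<sigma> x", OF F(2)] unfolding r_def by (cases "conj_fun F (\<sigma> x)") auto
      then show ?case using elim by (simp add: ennreal_leI)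
    qed
  qed
  also have "\<dots> = ennreal (\<integral>x. 1/2 * r \<sigma>1 x + 1/2 * r \<sigma>2 x \<partial>?M)"
    using c1(2) c2(2) r0 by (intro nn_integral_eq_integral) auto
  finally have fin\<sigma>: "conj_integral F \<Omega> \<sigma> \<noteq> \<infinity>" by (auto simp: top_unique)
  note c = conj[OF \<sigma> fin\<sigma>]
  define d where "d x = 1/2 * r \<sigma>1 x + 1/2 * r \<sigma>2 x - r \<sigma> x" for x
  have d: "integrable ?M d" unfolding d_def using c(2) c1(2) c2(2) by simp
  have d0: "AE x in ?M. 0 \<le> d x" using pt by eventually_elim (simp add: d_def)
  have dI: "(\<integral>x. d x \<partial>?M) = 1/2 * (\<integral>x. r \<sigma>1 x \<partial>?M) + 1/2 * (\<integral>x. r \<sigma>2 x \<partial>?M) - (\<integral>x. r \<sigma> x \<partial>?M)"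
    unfolding d_def using c(2) c1(2) c2(2) by simp
  have "ereal (m + (\<integral>x. d x \<partial>?M)) \<le> Rfun F \<Omega> D \<zeta> lam f \<sigma>"
    unfolding Rfun_def
  proof (rule INF_greatest)
    fix w assume w: "w \<in> ?W"
    let ?G = "weak_grad \<Omega> w"
    have iG: "integrable ?M ?G" using w by (intro integrable_weak_grad) auto
    have "ereal m \<le> lfun F \<Omega> D \<zeta> lam f w \<sigma>1" "ereal m \<le> lfun F \<Omega> D \<zeta> lam f w \<sigma>2"
      using order_trans[OF m1[unfolded Rfun_def] INF_lower[OF w]]
        order_trans[OF m2[unfolded Rfun_def] INF_lower[OF w]] by auto
    then have "m \<le> (\<integral>x. \<sigma>1 x \<bullet> ?G x \<partial>?M) + ?fid w - (\<integral>x. r \<sigma>1 x \<partial>?M)"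
      "m \<le> (\<integral>x. \<sigma>2 x \<bullet> ?G x \<partial>?M) + ?fid w - (\<integral>x. r \<sigma>2 x \<partial>?M)"
      using lreal[OF \<sigma>1 fin1 w] lreal[OF \<sigma>2 fin2 w] by auto
    moreover have "(\<integral>x. \<sigma> x \<bullet> ?G x \<partial>?M) = 1/2 * (\<integral>x. \<sigma>1 x \<bullet> ?G x \<partial>?M) + 1/2 * (\<integral>x. \<sigma>2 x \<bullet> ?G x \<partial>?M)"
      unfolding \<sigma>_def using integrable_Linf_inner[OF \<sigma>1 iG] integrable_Linf_inner[OF \<sigma>2 iG]
      by (simp add: inner_add_left)
    ultimately have "m + (\<integral>x. d x \<partial>?M) \<le> (\<integral>x. \<sigma> x \<bullet> ?G x \<partial>?M) + ?fid w - (\<integral>x. r \<sigma> x \<partial>?M)"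
      unfolding dI by linarith
    then show "ereal (m + (\<integral>x. d x \<partial>?M)) \<le> lfun F \<Omega> D \<zeta> lam f w \<sigma>"
      using lreal[OF \<sigma> fin\<sigma> w] by simp
  qed
  also have "\<dots> \<le> ereal m" by (rule max1[OF \<sigma>])
  finally have "(\<integral>x. d x \<partial>?M) \<le> 0" by simp
  moreover have "0 \<le> (\<integral>x. d x \<partial>?M)" using d0 by (rule integral_nonneg_AE)
  ultimately have "AE x in ?M. d x = 0"
    using integral_nonneg_eq_0_iff_AE[OF d d0] by simp
  then show ?thesis using pt
    by eventually_elim (auto simp: d_def)
qed

theorem theorem1p2:
  fixes \<Omega> D :: "(real^'n) set"
    and f :: "real^'n \<Rightarrow> real^'m"
    and F :: "real^'n^'m \<Rightarrow> real"
    and DF :: "real^'n^'m \<Rightarrow> real^'n^'m"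
    and \<zeta> lam \<nu>1 \<nu>2 \<nu>3 :: real
  assumes n2: "CARD('n) \<ge> 2"
    and dom: "lipschitz_domain \<Omega>" and bdd: "bounded \<Omega>"
    and Dsub: "D \<subseteq> \<Omega>" and Dmeas: "D \<in> sets lebesgue"
    and Dlt: "emeasure lebesgue D < emeasure lebesgue \<Omega>"
    and zeta: "\<zeta> > 1" and lam: "lam > 0"
    and f: "f \<in> Lp \<zeta> (\<Omega> - D)"
    and Fnn: "\<forall>P. F P \<ge> 0"
    and Fderiv: "\<forall>P. (F has_derivative (\<lambda>H. DF P \<bullet> H)) (at P)"
    and DFcont: "continuous_on UNIV DF"
    and Fsc: "strict_convex_on UNIV F"
    and F0: "F 0 = 0"
    and nu: "\<nu>1 > 0" "\<nu>2 > 0"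
    and DFbd: "\<forall>P. norm (DF P) \<le> \<nu>1"
    and Fgrow: "\<forall>P. F P \<ge> \<nu>2 * norm P - \<nu>3"
  shows "(\<exists>\<sigma>\<in>Linf \<Omega>. \<forall>\<tau>\<in>Linf \<Omega>. Rfun F \<Omega> D \<zeta> lam f \<tau> \<le> Rfun F \<Omega> D \<zeta> lam f \<sigma>)
       \<and> (INF v \<in> W11 \<Omega> \<inter> Lp \<zeta> (\<Omega> - D). ereal (Ifun F \<Omega> D \<zeta> lam f v))
           = (SUP \<sigma> \<in> Linf \<Omega>. Rfun F \<Omega> D \<zeta> lam f \<sigma>)
       \<and> (strict_convex_on {p. conj_fun F p < \<infinity>} (\<lambda>p. real_of_ereal (conj_fun F p)) \<longrightarrow>
           (\<forall>\<sigma>1\<in>Linf \<Omega>. \<forall>\<sigma>2\<in>Linf \<Omega>.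
              (\<forall>\<tau>\<in>Linf \<Omega>. Rfun F \<Omega> D \<zeta> lam f \<tau> \<le> Rfun F \<Omega> D \<zeta> lam f \<sigma>1) \<longrightarrow>
              (\<forall>\<tau>\<in>Linf \<Omega>. Rfun F \<Omega> D \<zeta> lam f \<tau> \<le> Rfun F \<Omega> D \<zeta> lam f \<sigma>2) \<longrightarrow>
              (AE x in lebesgue_on \<Omega>. \<sigma>1 x = \<sigma>2 x)))"
proof -
  let ?W = "W11 \<Omega> \<inter> Lp \<zeta> (\<Omega> - D) :: (real^'n \<Rightarrow> real^'m) set"
  let ?R = "Rfun F \<Omega> D \<zeta> lam f"
  have op: "open \<Omega>" using dom by (simp add: lipschitz_domain_def)
  have z: "\<zeta> \<ge> 1" "lam \<ge> 0" using zeta lam by auto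
  have cF: "continuous_on UNIV F"
    using Fderiv by (intro continuous_at_imp_continuous_on ballI has_derivative_continuous) blast
  \<comment> \<open>The mean value inequality turns the bound on the derivative into the Lipschitz
    constant \<nu>1.\<close>
  have lip: "\<bar>F A - F B\<bar> \<le> \<nu>1 * norm (A - B)" for A B
  proof -
    have "norm (F A - F B) \<le> \<nu>1 * norm (A - B)"
    proof (rule differentiable_bound[of UNIV])
      show "onorm (\<lambda>H. DF P \<bullet> H) \<le> \<nu>1" for P
      proof (rule onorm_le)
        fix H
        have "norm (DF P \<bullet> H) \<le> norm (DF P) * norm H" by (simp add: Cauchy_Schwarz_ineq2)
        also have "\<dots> \<le> \<nu>1 * norm H" using DFbd by (intro mult_right_mono) auto
        finally show "norm (DF P \<bullet> H) \<le> \<nu>1 * norm H" .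
      qed
    qed (use Fderiv in auto)
    then show ?thesis by simp
  qed
  have Fconv: "convex_on UNIV F"
  proof (rule convex_onI)
    fix t :: real and x y :: "real^'n^'m"
    assume t: "0 < t" "t < 1"
    show "F ((1 - t) *\<^sub>R x + t *\<^sub>R y) \<le> (1 - t) * F x + t * F y"
    proof (cases "x = y")
      case True
      then show ?thesis by (simp add: algebra_simps)
    next
      case False
      then have "F ((1 - t) *\<^sub>R x + t *\<^sub>R y) < (1 - t) * F x + t * F y"
        using Fsc t unfolding strict_convex_on_def by blast
      then show ?thesis by simp
    qed
  qed simp
  have W0: "(\<lambda>_. 0) \<in> ?W" by (rule zero_in_W11_Lp)
  define m where "m = (INF v\<in>?W. Ifun F \<Omega> D \<zeta> lam f v)"
  \<comment> \<open>Since I is nonnegative and admissible functions exist, the extended infimum is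
    the real number m.\<close>
  have "bdd_below (Ifun F \<Omega> D \<zeta> lam f ` ?W)"
  proof (rule bdd_belowI2)
    show "0 \<le> Ifun F \<Omega> D \<zeta> lam f v" for v
      unfolding Ifun_def using Fnn fidelity_nonneg[of \<zeta> lam] z by (intro add_nonneg_nonneg integral_nonneg_AE) auto
  qed
  then have m: "(INF v\<in>?W. ereal (Ifun F \<Omega> D \<zeta> lam f v)) = ereal m"
    unfolding m_def using W0 by (subst ereal_Inf') (auto simp: image_comp)
  have weak: "?R \<tau> \<le> ereal m" if "\<tau> \<in> Linf \<Omega>" for \<tau>
    unfolding m[symmetric] Rfun_def
    by (rule INF_mono) (use weak_duality[OF cF F0 lip that] in blast)
  obtain \<sigma> where \<sigma>: "\<sigma> \<in> Linf \<Omega>" "ereal m \<le> ?R \<sigma>"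
    using dual_solution_exists[where F=F, OF op bdd z f _ F0 Fconv lip] Fnn unfolding m_def by blast
  have "(SUP \<sigma>\<in>Linf \<Omega>. ?R \<sigma>) = ereal m"
  proof (rule antisym)
    show "(SUP \<sigma>\<in>Linf \<Omega>. ?R \<sigma>) \<le> ereal m" by (rule SUP_least) (rule weak)
    show "ereal m \<le> (SUP \<sigma>\<in>Linf \<Omega>. ?R \<sigma>)" by (rule order_trans[OF \<sigma>(2)]) (rule SUP_upper[OF \<sigma>(1)])
  qed
  moreover have "AE x in lebesgue_on \<Omega>. \<sigma>1 x = \<sigma>2 x"
    if "strict_convex_on {p. conj_fun F p < \<infinity>} (\<lambda>p. real_of_ereal (conj_fun F p))"
      "\<sigma>1 \<in> Linf \<Omega>" "\<sigma>2 \<in> Linf \<Omega>" "\<forall>\<tau>\<in>Linf \<Omega>. ?R \<tau> \<le> ?R \<sigma>1" "\<forall>\<tau>\<in>Linf \<Omega>. ?R \<tau> \<le> ?R \<sigma>2" for \<sigma>1 \<sigma>2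
  proof (rule dual_solution_unique[OF cF F0 that(1-3) weak])
    \<comment> \<open>Any maximizer does at least as well as the \<sigma> already constructed, whose
      value is at least m.\<close>
    show "ereal m \<le> ?R \<sigma>1" "ereal m \<le> ?R \<sigma>2" using that \<sigma> order_trans by blast+
    show "?W \<noteq> {}" using W0 by blast
  qed
  moreover have "\<forall>\<tau>\<in>Linf \<Omega>. ?R \<tau> \<le> ?R \<sigma>" using weak \<sigma>(2) order_trans by blast
  ultimately show ?thesis using m \<sigma>(1) by auto
qed

end
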